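(* Let $(M,d)$ be a (nonempty) compact and perfect metric space, let $X=M^{\mathbb{Z}}$ be endowed with the metric $$r(x,y)=\sum_{n\in\mathbb{Z}}\min\left\{\frac{1}{a_{|n|}+1},\,d(x_n,y_n)\right\},$$ where $(a_n)_{n\ge 0}$ is any monotone increasing sequence of nonnegative real numbers such that $\sum_{k\ge 0}\frac{1}{a_k+1}<\infty$ and, for each $\alpha>0$, $\lim_{k\to\infty}\frac{a_k}{e^{\alpha k}}=0$. Let $T:X\to X$ be the full-shift, $(Tx)_i=x_{i-1}$ for $i\in\mathbb{Z}$. Then each of the sets $$ED_-=\{\mu\in\mathcal{M}(T)\mid D^-_\mu(1)=0\},\qquad ED_+=\{\mu\in\mathcal{M}(T)\mid D^+_\mu(1)=+\infty\}$$ is residual in $\mathcal{M}(T)$.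
   Context: A metric space is perfect if it has no isolated points. $\mathcal{M}(T)$ is the space of $T$-invariant Borel probability measures on $X$, endowed with the weak topology ($\mu_\alpha\to\mu$ iff $\int f\,d\mu_\alpha\to\int f\,d\mu$ for every bounded continuous $f:X\to\mathbb{R}$). A subset of a topological space is residual if it contains a countable intersection of open dense sets. The upper and lower entropy dimensions of a Borel probability measure $\mu$ on $X$ are $D^+_\mu(1)=\limsup_{\varepsilon\downarrow 0}\frac{\int_{\operatorname{supp}(\mu)}\log\mu(B(x,\varepsilon))\,d\mu(x)}{\log\varepsilon}$ and $D^-_\mu(1)=\liminf_{\varepsilon\downarrow 0}\frac{\int_{\operatorname{supp}(\mu)}\log\mu(B(x,\varepsilon))\,d\mu(x)}{\log\varepsilon}$, where $B(x,\varepsilon)$ is the open $r$-ball and $\operatorname{supp}(\mu)$ the topological support. *)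

theory Defs
  imports "HOL-Probability.Probability"
begin

definition residual_in :: "'b topology \<Rightarrow> 'b set \<Rightarrow> bool" where
  "residual_in Y A \<longleftrightarrow> A \<subseteq> topspace Y \<and>
     (\<exists>U :: nat \<Rightarrow> 'b set. (\<forall>n. openin Y (U n) \<and> Y closure_of (U n) = topspace Y) \<and> (\<Inter>n. U n) \<subseteq> A)"

definition borel_prob_measures :: "'b topology \<Rightarrow> 'b measure set" where
  "borel_prob_measures Y =
     {\<mu>. prob_space \<mu> \<and> sets \<mu> = sigma_sets (topspace Y) {U. openin Y U} \<and> space \<mu> = topspace Y}"

definition msupport :: "'b topology \<Rightarrow> 'b measure \<Rightarrow> 'b set" where
  "msupport Y \<mu> = {x \<in> topspace Y. \<forall>U. openin Y U \<and> x \<in> U \<longrightarrow> emeasure \<mu> U > 0}"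

text \<open>The coarsest topology making \<open>\<mu> \<mapsto> \<integral>f d\<mu>\<close> continuous for every bounded continuous \<open>f\<close>;
  see \<open>limitin_weak_topology\<close> below for its convergence.\<close>

definition weak_topology :: "'b topology \<Rightarrow> 'b measure topology" where
  "weak_topology Y = topology_generated_by
     {{\<mu> \<in> borel_prob_measures Y. (\<integral>x. f x \<partial>\<mu>) \<in> V} | f V.
        continuous_map Y euclideanreal f \<and> bounded (f ` topspace Y) \<and> open V}"

definition invariant_measures :: "'b topology \<Rightarrow> ('b \<Rightarrow> 'b) \<Rightarrow> 'b measure set" where
  "invariant_measures Y T =
     {\<mu> \<in> borel_prob_measures Y. T \<in> measurable \<mu> \<mu> \<and> distr \<mu> \<mu> T = \<mu>}"

definition invariant_measure_topology :: "'b topology \<Rightarrow> ('b \<Rightarrow> 'b) \<Rightarrow> 'b measure topology" where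
  "invariant_measure_topology Y T = subtopology (weak_topology Y) (invariant_measures Y T)"

lemma topspace_weak_topology [simp]: "topspace (weak_topology Y) = borel_prob_measures Y"
proof -
  have "\<exists>S. S \<in> {{\<mu> \<in> borel_prob_measures Y. (\<integral>x. f x \<partial>\<mu>) \<in> V} | f V.
        continuous_map Y euclideanreal f \<and> bounded (f ` topspace Y) \<and> open V} \<and> \<mu> \<in> S"
    if "\<mu> \<in> borel_prob_measures Y" for \<mu>
    by (rule exI[of _ "{\<mu> \<in> borel_prob_measures Y. (\<integral>x. (\<lambda>_. 0::real) x \<partial>\<mu>) \<in> UNIV}"],
        intro conjI CollectI exI[of _ "\<lambda>_. 0::real"] exI[of _ "UNIV :: real set"])
       (use that in \<open>auto intro: finite_imp_bounded simp: image_constant_conv\<close>)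
  then show ?thesis
    unfolding weak_topology_def topology_generated_by_topspace by blast
qed

lemma limitin_weak_topology:
  assumes mem: "\<forall>\<^sub>F i in F. \<mu>s i \<in> borel_prob_measures Y"
    and lim_mem: "\<mu> \<in> borel_prob_measures Y"
  shows "limitin (weak_topology Y) \<mu>s \<mu> F \<longleftrightarrow>
    (\<forall>f. continuous_map Y euclideanreal f \<and> bounded (f ` topspace Y) \<longrightarrow>
       ((\<lambda>i. \<integral>x. f x \<partial>(\<mu>s i)) \<longlongrightarrow> (\<integral>x. f x \<partial>\<mu>)) F)"
    (is "?L \<longleftrightarrow> ?R")
proof
  assume L: ?L
  show ?R
  proof (intro allI impI topological_tendstoI)
    fix f V assume f: "continuous_map Y euclideanreal f \<and> bounded (f ` topspace Y)"
      and V: "open V" "(\<integral>x. f x \<partial>\<mu>) \<in> V"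
    let ?U = "{\<nu> \<in> borel_prob_measures Y. (\<integral>x. f x \<partial>\<nu>) \<in> V}"
    have "openin (weak_topology Y) ?U"
      unfolding weak_topology_def by (rule topology_generated_by_Basis) (use f V in blast)
    then have "\<forall>\<^sub>F i in F. \<mu>s i \<in> ?U"
      using L V lim_mem by (auto simp: limitin_def)
    then show "\<forall>\<^sub>F i in F. (\<integral>x. f x \<partial>(\<mu>s i)) \<in> V"
      by (rule eventually_mono) auto
  qed
next
  assume R: ?R
  let ?B = "{{\<mu> \<in> borel_prob_measures Y. (\<integral>x. f x \<partial>\<mu>) \<in> V} | f V.
        continuous_map Y euclideanreal f \<and> bounded (f ` topspace Y) \<and> open V}"
  have "\<mu> \<in> U \<longrightarrow> (\<forall>\<^sub>F i in F. \<mu>s i \<in> U)" if "generate_topology_on ?B U" for U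
    using that
  proof (induction rule: generate_topology_on.induct)
    case (Int a b)
    then show ?case by (auto intro: eventually_conj)
  next
    case (UN K)
    show ?case
    proof
      assume "\<mu> \<in> \<Union>K"
      then obtain k where k: "k \<in> K" "\<mu> \<in> k" by blast
      then have "\<forall>\<^sub>F i in F. \<mu>s i \<in> k" using UN.IH by blast
      then show "\<forall>\<^sub>F i in F. \<mu>s i \<in> \<Union>K"
        by (rule eventually_mono) (use k in blast)
    qed
  next
    case (Basis s)
    then obtain f V where s: "s = {\<mu> \<in> borel_prob_measures Y. (\<integral>x. f x \<partial>\<mu>) \<in> V}"
      and f: "continuous_map Y euclideanreal f \<and> bounded (f ` topspace Y)" and V: "open V"
      by blast
    show ?case
    proof
      assume "\<mu> \<in> s"
      then have "\<forall>\<^sub>F i in F. (\<integral>x. f x \<partial>(\<mu>s i)) \<in> V"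
        using R f V s by (auto dest: topological_tendstoD)
      with mem show "\<forall>\<^sub>F i in F. \<mu>s i \<in> s"
        by (rule eventually_elim2) (simp add: s)
    qed
  qed simp
  then show ?L
    by (auto simp: limitin_def lim_mem) (simp add: weak_topology_def openin_topology_generated_by_iff)
qed

text \<open>For fixed \<open>\<epsilon>\<close>, \<open>x \<mapsto> \<mu>(B(x,\<epsilon>))\<close> is lower semicontinuous and positive on the support. On a
  compact space it is therefore bounded away from 0 there, so the Bochner integral below is that
  of a bounded measurable function. (On a non-compact space the mathematical integral can be
  \<open>-\<infinity>\<close>, which this definition does not represent.)\<close>

definition (in Metric_space) entropy_quotient :: "'a measure \<Rightarrow> real \<Rightarrow> real" where
  "entropy_quotient \<mu> \<epsilon> = (LINT x : msupport mtopology \<mu> | \<mu>. ln (measure \<mu> (mball x \<epsilon>))) / ln \<epsilon>"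

definition (in Metric_space) upper_entropy_dim :: "'a measure \<Rightarrow> ereal" where
  "upper_entropy_dim \<mu> = Limsup (at_right 0) (\<lambda>\<epsilon>. ereal (entropy_quotient \<mu> \<epsilon>))"

definition (in Metric_space) lower_entropy_dim :: "'a measure \<Rightarrow> ereal" where
  "lower_entropy_dim \<mu> = Liminf (at_right 0) (\<lambda>\<epsilon>. ereal (entropy_quotient \<mu> \<epsilon>))"

text \<open>The space of bi-infinite sequences is always used with
  \<open>seq_dist\<close> below, never with the \<open>dist\<close> that the library puts on function types.\<close>

definition seq_dist :: "(nat \<Rightarrow> real) \<Rightarrow> (int \<Rightarrow> 'a::metric_space) \<Rightarrow> (int \<Rightarrow> 'a) \<Rightarrow> real" where
  "seq_dist a x y = (\<Sum>\<^sub>\<infinity>n. min (1 / (a (nat \<bar>n\<bar>) + 1)) (dist (x n) (y n)))"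

definition full_shift :: "(int \<Rightarrow> 'a) \<Rightarrow> (int \<Rightarrow> 'a)" where
  "full_shift x = (\<lambda>i. x (i - 1))"

abbreviation seq_topology :: "(nat \<Rightarrow> real) \<Rightarrow> (int \<Rightarrow> 'a::metric_space) topology" where
  "seq_topology a \<equiv> Metric_space.mtopology UNIV (seq_dist a)"

lemma summable_on_nat_abs:
  fixes g :: "nat \<Rightarrow> real"
  assumes "\<And>k. 0 \<le> g k" "summable g"
  shows "(\<lambda>n::int. g (nat \<bar>n\<bar>)) summable_on UNIV"
proof -
  have g: "g summable_on UNIV"
    using assms by (simp add: summable_on_UNIV_nonneg_real_iff)
  have "(\<lambda>n::int. g (nat \<bar>n\<bar>)) summable_on (range int)"
    using g by (subst summable_on_reindex) (auto simp: o_def)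
  moreover have "(\<lambda>n::int. g (nat \<bar>n\<bar>)) summable_on (range (\<lambda>k. - int k))"
    using g by (subst summable_on_reindex) (auto simp: o_def inj_on_def)
  ultimately have "(\<lambda>n::int. g (nat \<bar>n\<bar>)) summable_on (range int \<union> range (\<lambda>k. - int k))"
    by (rule summable_on_union)
  moreover have "range int \<union> range (\<lambda>k. - int k) = UNIV"
    by (auto simp: image_iff) (metis int_cases2)
  ultimately show ?thesis by simp
qed

lemma Metric_space_seq_dist:
  fixes a :: "nat \<Rightarrow> real"
  assumes a: "\<And>k. 0 \<le> a k" and sum: "summable (\<lambda>k. 1 / (a k + 1))"
  shows "Metric_space UNIV (seq_dist a :: (int \<Rightarrow> 'a::metric_space) \<Rightarrow> _)"
proof -
  define t where "t x y n = min (1 / (a (nat \<bar>n\<bar>) + 1)) (dist (x n) (y n))" for x y :: "int \<Rightarrow> 'a" and n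
  have pos: "0 < 1 / (a k + 1)" for k
    using a[of k] by simp
  have t0: "0 \<le> t x y n" for x y n
    using pos[of "nat \<bar>n\<bar>"] by (simp add: t_def)
  have S: "(t x y) summable_on UNIV" for x y
    by (rule summable_on_comparison_test[OF summable_on_nat_abs[OF less_imp_le[OF pos] sum]])
       (use t0 in \<open>auto simp: t_def\<close>)
  have d: "seq_dist a x y = infsum (t x y) UNIV" for x y
    unfolding seq_dist_def t_def ..
  show ?thesis
  proof
    fix x y z :: "int \<Rightarrow> 'a"
    show "0 \<le> seq_dist a x y"
      unfolding d by (rule infsum_nonneg) (rule t0)
    show "seq_dist a x y = seq_dist a y x"
      by (simp add: seq_dist_def dist_commute)
    show "seq_dist a x y = 0 \<longleftrightarrow> x = y"
    proof
      assume "seq_dist a x y = 0"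
      then have "t x y n = 0" for n
        unfolding d by (intro nonneg_infsum_le_0D[OF _ S]) (use t0 in auto)
      then show "x = y"
        using pos unfolding t_def min_def by (metis dist_eq_0_iff ext less_irrefl)
    next
      assume "x = y"
      then have "t x y n = 0" for n
        using pos[of "nat \<bar>n\<bar>"] by (simp add: t_def)
      then show "seq_dist a x y = 0"
        unfolding d by (intro infsum_0)
    qed
    have "t x z n \<le> t x y n + t y z n" for n
      using pos[of "nat \<bar>n\<bar>"] dist_triangle[of "x n" "z n" "y n"]
        zero_le_dist[of "x n" "y n"] zero_le_dist[of "y n" "z n"]
      unfolding t_def by linarith
    then have "infsum (t x z) UNIV \<le> infsum (\<lambda>n. t x y n + t y z n) UNIV"
      by (intro infsum_mono S summable_on_add)
    then show "seq_dist a x z \<le> seq_dist a x y + seq_dist a y z"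
      by (simp add: d infsum_add[OF S S])
  qed
qed

end

theory Submission
  imports Defs
begin

text \<open>Invariant measures of the full shift are weak limits of measures on periodic orbits, obtained by
  concatenating long pieces of points whose empirical measure approximates \<open>\<mu>\<close>; one symbol in each
  long period may be changed at will.

  Near a measure on \<open>p\<close> atoms, the integral of \<open>-ln \<mu>(B(x,\<epsilon>))\<close> is at most \<open>p + 1\<close>, which
  is negligible against \<open>-ln \<epsilon>\<close> once \<open>\<epsilon>\<close> is small: this makes the lower dimension 0 generically.
  If instead the free symbols run through all binary words of length \<open>k\<close>, every ball of radius
  \<open>\<epsilon> = 1/(a\<^bsub>kp\<^esub> + 1)\<close> has mass at most \<open>2\<^bsup>-k\<^esup>\<close>, since it prescribes a window of
  radius \<open>kp\<close>. This persists for all nearby measures at radius \<open>\<epsilon>/2\<close>, and \<open>-ln \<epsilon> = o(k)\<close> because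
  \<open>a\<close> grows subexponentially: this makes the upper dimension infinite generically.\<close>

section \<open>The metric of the sequence space induces the product topology\<close>

text \<open>Weak closeness gives no lower bound for the masses of small balls, so \<open>-ln\<close>
  of them cannot be bounded pointwise near a periodic orbit measure. Its integral is compared
  instead with the sum of \<open>-m ln m\<close> over finitely many cells of small diameter: each
  term is at most 1 however small \<open>m\<close> is, and tends to 0 with \<open>m\<close>. Upper
  bounds for ball masses do survive weak perturbation, at the price of a smaller radius.

  Each level of the two countable intersections asks for one small radius, and the order of choices
  matters: a nonempty open set of measures first fixes the word and its period \<open>p\<close>; the
  radius or \<open>k\<close> is chosen afterwards. The free symbols have density \<open>1/p\<close>,
  so the information in a window of radius \<open>kp\<close> grows linearly in \<open>k\<close> and
  eventually beats any multiple of \<open>ln a\<close> at \<open>kp\<close>. Changing a free symbol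
  is harmless for the approximation: it matters only near the joints between pieces, which the
  estimate has already written off.\<close>

lemma seq_dist_term_le:
  fixes x y :: "int \<Rightarrow> 'a::metric_space"
  assumes a: "\<And>k. 0 \<le> a k" and sum: "summable (\<lambda>k. 1 / (a k + 1))"
  shows "min (1 / (a (nat \<bar>n\<bar>) + 1)) (dist (x n) (y n)) \<le> seq_dist a x y"
proof -
  let ?t = "\<lambda>n. min (1 / (a (nat \<bar>n\<bar>) + 1)) (dist (x n) (y n))"
  have pos: "0 \<le> 1 / (a k + 1)" for k
    using a[of k] by simp
  have S: "?t summable_on UNIV"
    by (rule summable_on_comparison_test[OF summable_on_nat_abs[OF pos sum]]) (use pos in auto)
  have "infsum ?t {n} \<le> infsum ?t UNIV"
    by (rule infsum_mono_neutral) (use S pos in auto)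
  then show ?thesis
    by (simp add: seq_dist_def)
qed

text \<open>Below the cutoff of coordinate \<open>n\<close> the minimum in the metric must be
  attained by the distance. This is how a small ball prescribes a whole window of
  coordinates.\<close>

lemma dist_less_if_seq_dist_less:
  fixes x y :: "int \<Rightarrow> 'a::metric_space"
  assumes "\<And>k. 0 \<le> a k" "summable (\<lambda>k. 1 / (a k + 1))"
    and "seq_dist a x y < e" "e \<le> 1 / (a (nat \<bar>n\<bar>) + 1)"
  shows "dist (x n) (y n) < e"
  using seq_dist_term_le[of a n x y] assms by (auto simp: min_def split: if_splits)

text \<open>The cutoffs form a summable majorant independent of \<open>y\<close>, so the finite
  partial sums, continuous in the product topology, converge uniformly.\<close>

lemma continuous_on_seq_dist:
  fixes x :: "int \<Rightarrow> 'a::metric_space"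
  assumes a: "\<And>k. 0 \<le> a k" and sum: "summable (\<lambda>k. 1 / (a k + 1))"
  shows "continuous_on UNIV (seq_dist a x)"
proof -
  let ?t = "\<lambda>n y. min (1 / (a (nat \<bar>n\<bar>) + 1)) (dist (x n) (y n))"
  have pos: "0 \<le> 1 / (a k + 1)" for k
    using a[of k] by simp
  have "uniform_limit UNIV (\<lambda>F y. \<Sum>n\<in>F. ?t n y) (\<lambda>y. \<Sum>\<^sub>\<infinity>n. ?t n y) (finite_subsets_at_top UNIV)"
    by (rule Weierstrass_m_test_general[OF _ summable_on_nat_abs[OF pos sum]]) (use pos in auto)
  moreover have "\<forall>\<^sub>F F in finite_subsets_at_top UNIV. continuous_on UNIV (\<lambda>y. \<Sum>n\<in>F. ?t n y)"
    by (intro always_eventually allI continuous_intros continuous_on_product_coordinates)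
  ultimately have "continuous_on UNIV (\<lambda>y. \<Sum>\<^sub>\<infinity>n. ?t n y)"
    by (intro uniform_limit_theorem) auto
  then show ?thesis
    by (simp add: seq_dist_def[abs_def])
qed

text \<open>Makes Tychonoff's theorem, coordinatewise continuity and the Borel sets of the product
  topology available, while balls remain those of \<open>seq_dist\<close>.\<close>

lemma seq_topology_eq_euclidean:
  assumes a: "\<And>k. 0 \<le> a k" and sum: "summable (\<lambda>k. 1 / (a k + 1))"
  shows "(seq_topology a :: (int \<Rightarrow> 'a::metric_space) topology) = euclidean"
proof -
  interpret Metric_space UNIV "seq_dist a :: (int \<Rightarrow> 'a) \<Rightarrow> _"
    using assms by (rule Metric_space_seq_dist)
  have "continuous_map euclidean mtopology (\<lambda>x. x)"
    unfolding continuous_map_to_metric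
  proof (intro ballI allI impI)
    fix x :: "int \<Rightarrow> 'a" and e :: real assume e: "0 < e"
    have "open {y. seq_dist a x y < e}"
      by (intro open_Collect_less continuous_on_seq_dist assms continuous_on_const)
    then show "\<exists>U. openin euclidean U \<and> x \<in> U \<and> (\<forall>y\<in>U. y \<in> mball x e)"
      using e by (intro exI[of _ "{y. seq_dist a x y < e}"]) auto
  qed
  moreover have "continuous_map mtopology euclidean (\<lambda>x. x n)" for n
    unfolding continuous_map_iff_continuous2
  proof (subst mtopology_is_euclidean[symmetric], subst Met_TC.continuous_map_to_metric,
      intro ballI allI impI)
    fix x :: "int \<Rightarrow> 'a" and e :: real assume e: "0 < e"
    define \<delta> where "\<delta> = min e (1 / (a (nat \<bar>n\<bar>) + 1))"
    have "0 < \<delta>"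
      using e a[of "nat \<bar>n\<bar>"] by (simp add: \<delta>_def)
    moreover have "dist (x n) (y n) < \<delta>" if "seq_dist a x y < \<delta>" for y
      using dist_less_if_seq_dist_less[OF assms that] by (simp add: \<delta>_def)
    ultimately show "\<exists>U. openin mtopology U \<and> x \<in> U \<and> (\<forall>y\<in>U. y n \<in> Met_TC.mball (x n) e)"
      by (intro exI[of _ "mball x \<delta>"]) (force simp: \<delta>_def)
  qed
  then have "continuous_map mtopology euclidean (\<lambda>x. x)"
    by (subst euclidean_product_topology[symmetric])
       (simp add: continuous_map_componentwise_UNIV)
  ultimately show ?thesis
    by (intro topology_eq[THEN iffD2] allI)
       (auto simp: continuous_map_def)
qed

lemma compact_UNIV_fun:
  assumes "compact (UNIV :: 'a::topological_space set)"
  shows "compact (UNIV :: ('i \<Rightarrow> 'a) set)"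
proof -
  have "compact_space (euclidean :: 'a topology)"
    using assms by (simp add: compact_space_def)
  then have "compact_space (product_topology (\<lambda>_. euclidean :: 'a topology) (UNIV :: 'i set))"
    by (simp add: compact_space_product_topology)
  then show ?thesis
    by (simp add: euclidean_product_topology compact_space_def)
qed

lemma continuous_on_full_shift: "continuous_on S full_shift"
  unfolding full_shift_def 
  by (intro continuous_on_coordinatewise_then_product continuous_on_subset[OF continuous_on_product_coordinates]) auto

section \<open>Entropy bounds on a compact metrizable space\<close>

lemma borel_prob_measures_euclidean:
  "\<mu> \<in> borel_prob_measures euclidean \<longleftrightarrow> prob_space \<mu> \<and> sets \<mu> = sets borel"
  using sets_eq_imp_space_eq[of \<mu> borel] by (auto simp: borel_prob_measures_def sets_borel)

lemma integrable_continuous_on_bounded: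
  fixes f :: "'b::topological_space \<Rightarrow> real"
  assumes \<mu>: "\<mu> \<in> borel_prob_measures euclidean" and f: "continuous_on UNIV f" "bounded (range f)"
  shows "integrable \<mu> f"
proof -
  interpret prob_space \<mu>
    using \<mu> by (simp add: borel_prob_measures_euclidean)
  obtain B where "\<And>x. norm (f x) \<le> B"
    using f(2) by (auto simp: bounded_iff)
  moreover have "f \<in> borel_measurable \<mu>"
    using \<mu> f(1) by (simp add: borel_prob_measures_euclidean borel_measurable_continuous_onI
        cong: measurable_cong_sets)
  ultimately show ?thesis
    by (intro integrable_const_bound[of _ B]) auto
qed

lemma openin_weak_topology_integral:
  fixes f :: "'b::topological_space \<Rightarrow> real"
  assumes "continuous_on UNIV f" "bounded (range f)" "open V"
  shows "openin (weak_topology euclidean) {\<mu> \<in> borel_prob_measures euclidean. (\<integral>x. f x \<partial>\<mu>) \<in> V}"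
  unfolding weak_topology_def
  by (rule topology_generated_by_Basis, rule CollectI, rule exI[of _ f], rule exI[of _ V])
     (use assms in auto)

lemma closed_msupport: "closed (msupport euclidean \<mu>)"
proof -
  have "- msupport euclidean \<mu> = \<Union>{U. open U \<and> emeasure \<mu> U = 0}"
    by (auto simp: msupport_def zero_less_iff_neq_zero)
  then have "open (- msupport euclidean \<mu>)"
    by (metis (no_types, lifting) mem_Collect_eq open_Union)
  then show ?thesis
    by (simp add: closed_def)
qed

text \<open>Measures and the weak topology come from the topology of the type, balls and entropy
  quotients from an explicit metric \<open>d\<close>; this allows \<open>seq_dist\<close> on a
  function type.\<close>

locale compact_metrized = Metric_space UNIV d
  for d :: "'b::topological_space \<Rightarrow> 'b \<Rightarrow> real" +
  assumes mtopology_eq: "mtopology = (euclidean :: 'b topology)"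
    and compact_UNIV: "compact (UNIV :: 'b set)"
begin

lemma open_mball: "open (mball x e)"
  using openin_mball[of x e] by (simp add: mtopology_eq)

lemma mball_borel: "mball x e \<in> sets borel"
  using open_mball by simp

lemma continuous_on_iff_d:
  fixes f :: "'b \<Rightarrow> real"
  shows "continuous_on UNIV f \<longleftrightarrow> (\<forall>x. \<forall>e>0. \<exists>\<delta>>0. \<forall>y. d x y < \<delta> \<longrightarrow> \<bar>f y - f x\<bar> < e)"
proof -
  have "continuous_on UNIV f \<longleftrightarrow> continuous_map mtopology Met_TC.mtopology f"
    by (simp add: mtopology_eq)
  then show ?thesis
    unfolding metric_continuous_map[OF Met_TC.Metric_space_axioms] by (simp add: dist_real_def abs_minus_commute)
qed

lemma continuous_on_d: "continuous_on UNIV (d x)"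
  unfolding continuous_on_iff_d
proof (intro allI impI)
  fix y and e :: real assume "0 < e"
  moreover have "\<bar>d x z - d x y\<bar> \<le> d y z" for z
    using triangle[of x y z] triangle[of x z y] commute[of y z] by simp
  ultimately show "\<exists>\<delta>>0. \<forall>z. d y z < \<delta> \<longrightarrow> \<bar>d x z - d x y\<bar> < e"
    using le_less_trans by blast
qed

lemma finite_mball_cover:
  assumes "0 < e"
  obtains C where "finite C" "(\<Union>c\<in>C. mball c e) = UNIV"
proof -
  have "mtotally_bounded UNIV"
    using compact_UNIV by (intro compactin_imp_mtotally_bounded) (simp add: mtopology_eq)
  then show ?thesis
    using assms that unfolding mtotally_bounded_def by (metis top.extremum_uniqueI)
qed

lemma bounded_range_continuous:
  fixes f :: "'b \<Rightarrow> real"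
  shows "continuous_on UNIV f \<Longrightarrow> bounded (range f)"
  by (intro compact_imp_bounded compact_continuous_image compact_UNIV)

text \<open>The complement of the support is a union of null open sets, a priori uncountable. Finite
  nets at the scales \<open>1 / Suc n\<close> replace it by a countable union of null balls.\<close>

lemma AE_msupport:
  fixes \<mu> :: "'b measure"
  assumes "sets \<mu> = sets borel"
  shows "AE x in \<mu>. x \<in> msupport euclidean \<mu>"
proof -
  have "\<forall>n. \<exists>C. finite C \<and> (\<Union>c\<in>C. mball c (1 / real (Suc n))) = UNIV"
  proof
    fix n
    show "\<exists>C. finite C \<and> (\<Union>c\<in>C. mball c (1 / real (Suc n))) = UNIV"
      by (rule finite_mball_cover[of "1 / real (Suc n)"]) auto
  qed
  then obtain C where C: "\<And>n::nat. finite (C n)" "\<And>n. (\<Union>c\<in>C n. mball c (1 / real (Suc n))) = UNIV"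
    by metis
  define Z where "Z n = {c \<in> C n. emeasure \<mu> (mball c (1 / real (Suc n))) = 0}" for n
  have null: "(\<Union>n. \<Union>c\<in>Z n. mball c (1 / real (Suc n))) \<in> null_sets \<mu>"
    by (intro null_sets_UN null_sets_UN')
       (use C(1) assms mball_borel in \<open>auto simp: Z_def null_sets_def countable_finite\<close>)
  show ?thesis
  proof (rule AE_I'[OF null], safe)
    fix x assume "x \<notin> msupport euclidean \<mu>"
    then obtain U where U: "open U" "x \<in> U" "emeasure \<mu> U = 0"
      by (auto simp: msupport_def zero_less_iff_neq_zero)
    then have "openin mtopology U"
      by (simp add: mtopology_eq)
    then obtain r where r: "0 < r" "mball x r \<subseteq> U"
      using U(2) unfolding openin_mtopology by auto
    obtain n where n: "1 / real (Suc n) < r / 2"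
      using r(1) nat_approx_posE[of "r / 2"] by auto
    have "x \<in> (\<Union>c\<in>C n. mball c (1 / real (Suc n)))"
      using C(2)[of n] by blast
    then obtain c where c: "c \<in> C n" "x \<in> mball c (1 / real (Suc n))"
      by blast
    have "mball c (1 / real (Suc n)) \<subseteq> U"
    proof
      fix y assume "y \<in> mball c (1 / real (Suc n))"
      then have "d x y < r"
        using c(2) n triangle[of x c y] commute[of x c] by simp
      then show "y \<in> U"
        using r(2) by auto
    qed
    then have "emeasure \<mu> (mball c (1 / real (Suc n))) = 0"
      using emeasure_mono[of "mball c (1 / real (Suc n))" U \<mu>] U assms by simp
    then show "x \<in> (\<Union>n. \<Union>c\<in>Z n. mball c (1 / real (Suc n)))"
      using c by (auto simp: Z_def)
  qed
qed

text \<open>Lower semicontinuity: an open ball is exhausted by smaller concentric ones, and such a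
  smaller ball stays inside the ball of radius \<open>e\<close> about every nearby centre.\<close>

lemma borel_measurable_measure_mball:
  assumes "\<mu> \<in> borel_prob_measures euclidean"
  shows "(\<lambda>x. measure \<mu> (mball x e)) \<in> borel_measurable \<mu>"
proof -
  have sets: "sets \<mu> = sets borel" and "prob_space \<mu>"
    using assms by (simp_all add: borel_prob_measures_euclidean)
  then interpret prob_space \<mu> by simp
  have "open {x. c < measure \<mu> (mball x e)}" for c
    unfolding open_openin mtopology_eq[symmetric] openin_mtopology
  proof (intro conjI allI impI)
    fix x assume "x \<in> {x. c < measure \<mu> (mball x e)}"
    then have x: "c < measure \<mu> (mball x e)" by simp
    have "mball x e = (\<Union>n. mball x (e - 1 / real (Suc n)))"
    proof (intro equalityI subsetI)
      fix y assume "y \<in> mball x e"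
      then obtain n where "1 / real (Suc n) < e - d x y"
        using nat_approx_posE[of "e - d x y"] by auto
      then show "y \<in> (\<Union>n. mball x (e - 1 / real (Suc n)))"
        by (auto intro!: exI[of _ n])
    next
      fix y assume "y \<in> (\<Union>n. mball x (e - 1 / real (Suc n)))"
      then obtain n where "d x y < e - 1 / real (Suc n)" by auto
      also have "\<dots> \<le> e" by simp
      finally show "y \<in> mball x e" by simp
    qed
    moreover have "incseq (\<lambda>n. mball x (e - 1 / real (Suc n)))"
      by (auto simp: incseq_def frac_le intro!: mball_subset_concentric)
    ultimately have "(\<lambda>n. measure \<mu> (mball x (e - 1 / real (Suc n)))) \<longlonglongrightarrow> measure \<mu> (mball x e)"
      using finite_Lim_measure_incseq[of "\<lambda>n. mball x (e - 1 / real (Suc n))"] mball_borel sets by auto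
    then obtain n where n: "c < measure \<mu> (mball x (e - 1 / real (Suc n)))"
      using x order_tendstoD(1) eventually_happens'[OF sequentially_bot] by blast
    have "mball x (1 / real (Suc n)) \<subseteq> {x. c < measure \<mu> (mball x e)}"
    proof (rule subsetI, rule CollectI)
      fix y assume y: "y \<in> mball x (1 / real (Suc n))"
      have "mball x (e - 1 / real (Suc n)) \<subseteq> mball y e"
      proof
        fix z assume "z \<in> mball x (e - 1 / real (Suc n))"
        then show "z \<in> mball y e"
          using y triangle[of y x z] commute[of x y] by simp
      qed
      then have "measure \<mu> (mball x (e - 1 / real (Suc n))) \<le> measure \<mu> (mball y e)"
        by (intro finite_measure_mono) (use mball_borel sets in auto)
      with n show "c < measure \<mu> (mball y e)" by simp
    qed
    then show "\<exists>r>0. mball x r \<subseteq> {x. c < measure \<mu> (mball x e)}"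
      by (intro exI[of _ "1 / real (Suc n)"]) simp
  qed simp
  then show ?thesis
    unfolding borel_measurable_iff_greater using sets by (simp add: sets_eq_imp_space_eq[OF sets])
qed

section \<open>Ball masses against finite covers by small cells\<close>

context
  fixes \<mu> :: "'b measure" assumes \<mu>: "\<mu> \<in> borel_prob_measures euclidean"
begin

interpretation prob_space \<mu>
  using \<mu> by (simp add: borel_prob_measures_euclidean)

lemma sets_eq_borel: "sets \<mu> = sets borel"
  using \<mu> by (simp add: borel_prob_measures_euclidean)

text \<open>A cell containing \<open>x\<close> lies in the ball about \<open>x\<close>, so it has
  smaller mass and larger \<open>-ln\<close>. Null cells must be discarded, because
  \<open>ln 0 = 0\<close> would break this comparison; they are finitely many, hence together
  null.\<close>

lemma AE_ln_measure_mball_ge: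
  assumes J: "finite J" "\<And>j. j \<in> J \<Longrightarrow> C j \<in> sets borel" "(\<Union>j\<in>J. C j) = UNIV"
    and C: "\<And>j x. j \<in> J \<Longrightarrow> x \<in> C j \<Longrightarrow> C j \<subseteq> mball x e"
  shows "AE x in \<mu>. - ln (measure \<mu> (mball x e)) \<le> (\<Sum>j\<in>J. indicator (C j) x * - ln (measure \<mu> (C j)))"
proof -
  have "AE x in \<mu>. \<forall>j\<in>J. x \<in> C j \<longrightarrow> measure \<mu> (C j) \<noteq> 0"
  proof (rule AE_finite_allI[OF J(1)])
    fix j assume "j \<in> J"
    then have "C j \<in> sets \<mu>"
      using J(2) sets_eq_borel by simp
    then show "AE x in \<mu>. x \<in> C j \<longrightarrow> measure \<mu> (C j) \<noteq> 0"
      using eventually_mono[OF AE_not_in[of "C j" \<mu>], of "\<lambda>x. x \<in> C j \<longrightarrow> measure \<mu> (C j) \<noteq> 0"]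
      by (cases "measure \<mu> (C j) = 0") (auto simp: null_sets_def emeasure_eq_measure)
  qed
  then show ?thesis
  proof (rule AE_mp, intro AE_I2 impI)
    fix x assume x: "\<forall>j\<in>J. x \<in> C j \<longrightarrow> measure \<mu> (C j) \<noteq> 0"
    obtain j where j: "j \<in> J" "x \<in> C j"
      using J(3) by auto
    have "0 < measure \<mu> (C j)" "measure \<mu> (C j) \<le> measure \<mu> (mball x e)"
      using x j C[OF j] mball_borel sets_eq_borel by (auto intro!: finite_measure_mono simp: less_le)
    then have "- ln (measure \<mu> (mball x e)) \<le> indicator (C j) x * - ln (measure \<mu> (C j))"
      using j by simp
    also have "\<dots> \<le> (\<Sum>j\<in>J. indicator (C j) x * - ln (measure \<mu> (C j)))"
      by (rule member_le_sum)
         (use j J(1) x in \<open>auto simp: indicator_def ln_le_zero_iff zero_less_measure_iff split: if_splits\<close>)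
    finally show "- ln (measure \<mu> (mball x e)) \<le> \<dots>" .
  qed
qed

lemma integrable_cell_sum:
  fixes c :: "'j \<Rightarrow> real"
  assumes "\<And>j. j \<in> J \<Longrightarrow> C j \<in> sets borel"
  shows "integrable \<mu> (\<lambda>x. \<Sum>j\<in>J. indicator (C j) x * c j)"
  using assms sets_eq_borel
  by (intro Bochner_Integration.integrable_sum integrable_mult_left) (simp add: emeasure_eq_measure)

lemma ln_measure_nonpos: "ln (measure \<mu> A) \<le> 0"
  by (cases "measure \<mu> A = 0") (auto simp: ln_le_zero_iff zero_less_measure_iff)

text \<open>Integrating the cell bound turns \<open>-ln m\<close> into the bounded quantity
  \<open>-m ln m\<close>. The cells may overlap, since the terms are nonnegative.\<close>

lemma neg_entropy_integral_le:
  assumes J: "finite J" "\<And>j. j \<in> J \<Longrightarrow> C j \<in> sets borel" "(\<Union>j\<in>J. C j) = UNIV"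
    and C: "\<And>j x. j \<in> J \<Longrightarrow> x \<in> C j \<Longrightarrow> C j \<subseteq> mball x e"
  shows "- (LINT x : msupport euclidean \<mu> | \<mu>. ln (measure \<mu> (mball x e)))
    \<le> (\<Sum>j\<in>J. - (measure \<mu> (C j) * ln (measure \<mu> (C j))))"
proof -
  let ?S = "\<lambda>x. \<Sum>j\<in>J. indicator (C j) x * - ln (measure \<mu> (C j))"
  have ge: "AE x in \<mu>. - ln (measure \<mu> (mball x e)) \<le> ?S x"
    by (rule AE_ln_measure_mball_ge[OF J C])
  have "(\<integral>x. - (indicator (msupport euclidean \<mu>) x *\<^sub>R ln (measure \<mu> (mball x e))) \<partial>\<mu>) \<le> (\<integral>x. ?S x \<partial>\<mu>)"
  \<comment> \<open>Nonnegativity of the majorant covers the default value 0 of the left integral in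
    case of non-integrability.\<close>
  proof (rule integral_mono_AE')
    show "integrable \<mu> ?S"
      using J(2) by (rule integrable_cell_sum)
    show "AE x in \<mu>. 0 \<le> ?S x"
      by (intro AE_I2 sum_nonneg mult_nonneg_nonneg) (auto simp: ln_measure_nonpos)
    show "AE x in \<mu>. - (indicator (msupport euclidean \<mu>) x *\<^sub>R ln (measure \<mu> (mball x e))) \<le> ?S x"
      using ge
    proof (rule AE_mp, intro AE_I2 impI)
      fix x assume "- ln (measure \<mu> (mball x e)) \<le> ?S x"
      with ln_measure_nonpos[of "mball x e"]
      show "- (indicator (msupport euclidean \<mu>) x *\<^sub>R ln (measure \<mu> (mball x e))) \<le> ?S x"
        by (cases "x \<in> msupport euclidean \<mu>") auto
    qed
  qed
  also have "(\<integral>x. ?S x \<partial>\<mu>) = (\<Sum>j\<in>J. - (measure \<mu> (C j) * ln (measure \<mu> (C j))))"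
    using J(2) sets_eq_borel
    by (subst Bochner_Integration.integral_sum) (auto intro!: sum.cong simp: emeasure_eq_measure)
  finally show ?thesis
    by (simp add: set_lebesgue_integral_def)
qed

lemma entropy_integral_le:
  assumes e: "0 < e" and s: "0 < s" "\<And>x. measure \<mu> (mball x e) \<le> s"
  shows "(LINT x : msupport euclidean \<mu> | \<mu>. ln (measure \<mu> (mball x e))) \<le> ln s"
proof -
  let ?S = "msupport euclidean \<mu>"
  obtain K where K: "finite K" "(\<Union>c\<in>K. mball c (e / 2)) = UNIV"
    using finite_mball_cover[of "e / 2"] e by auto
  have cell: "mball c (e / 2) \<subseteq> mball x e" if "x \<in> mball c (e / 2)" for c x
  proof
    fix y assume "y \<in> mball c (e / 2)"
    then show "y \<in> mball x e"
      using that triangle[of x c y] commute[of x c] by simp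
  qed
  have ge: "AE x in \<mu>. - ln (measure \<mu> (mball x e))
      \<le> (\<Sum>c\<in>K. indicator (mball c (e / 2)) x * - ln (measure \<mu> (mball c (e / 2))))"
    by (rule AE_ln_measure_mball_ge[OF K(1) mball_borel K(2) cell])
  \<comment> \<open>In this direction integrability is essential: the default value 0 would exceed
    \<open>ln s\<close> for \<open>s < 1\<close>. The cell sum is an integrable majorant.\<close>
  have "integrable \<mu> (\<lambda>x. indicator ?S x *\<^sub>R ln (measure \<mu> (mball x e)))"
  proof (rule Bochner_Integration.integrable_bound)
    show "integrable \<mu> (\<lambda>x. \<Sum>c\<in>K. indicator (mball c (e / 2)) x * - ln (measure \<mu> (mball c (e / 2))))"
      by (rule integrable_cell_sum) (rule mball_borel)
    have "?S \<in> sets \<mu>"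
      using closed_msupport[of \<mu>] sets_eq_borel by simp
    then show "(\<lambda>x. indicator ?S x *\<^sub>R ln (measure \<mu> (mball x e))) \<in> borel_measurable \<mu>"
      using borel_measurable_measure_mball[OF \<mu>, of e] by measurable
    show "AE x in \<mu>. norm (indicator ?S x *\<^sub>R ln (measure \<mu> (mball x e)))
      \<le> norm (\<Sum>c\<in>K. indicator (mball c (e / 2)) x * - ln (measure \<mu> (mball c (e / 2))))"
      using ge
    proof (rule AE_mp, intro AE_I2 impI)
      fix x
      assume "- ln (measure \<mu> (mball x e))
        \<le> (\<Sum>c\<in>K. indicator (mball c (e / 2)) x * - ln (measure \<mu> (mball c (e / 2))))"
      with ln_measure_nonpos[of "mball x e"]
      show "norm (indicator ?S x *\<^sub>R ln (measure \<mu> (mball x e)))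
        \<le> norm (\<Sum>c\<in>K. indicator (mball c (e / 2)) x * - ln (measure \<mu> (mball c (e / 2))))"
        by (cases "x \<in> ?S") auto
    qed
  qed
  \<comment> \<open>On the support the ball has positive mass; for a null ball the value
    \<open>ln 0 = 0\<close> could violate the bound.\<close>
  moreover have "AE x in \<mu>. indicator ?S x *\<^sub>R ln (measure \<mu> (mball x e)) \<le> ln s"
    using AE_msupport[OF sets_eq_borel]
  proof (rule AE_mp, intro AE_I2 impI)
    fix x assume x: "x \<in> ?S"
    then have "0 < measure \<mu> (mball x e)"
      using open_mball[of x e] e by (auto simp: msupport_def emeasure_eq_measure)
    then show "indicator ?S x *\<^sub>R ln (measure \<mu> (mball x e)) \<le> ln s"
      using x s by simp
  qed
  ultimately have "(\<integral>x. indicator ?S x *\<^sub>R ln (measure \<mu> (mball x e)) \<partial>\<mu>) \<le> (\<integral>x. ln s \<partial>\<mu>)"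
    by (intro integral_mono_AE) auto
  then show ?thesis
    by (simp add: set_lebesgue_integral_def prob_space)
qed

end

end

section \<open>Open sets of measures with controlled entropy\<close>

lemma neg_mult_ln_le_1:
  fixes m :: real
  assumes "0 \<le> m"
  shows "- (m * ln m) \<le> 1"
proof (cases "m = 0")
  case False
  then have "- ln m \<le> 1 / m - 1"
    using assms ln_le_minus_one[of "1 / m"] by (simp add: ln_div)
  then have "m * - ln m \<le> m * (1 / m - 1)"
    using assms by (intro mult_left_mono)
  then show ?thesis
    using False assms by (simp add: algebra_simps)
qed simp

text \<open>The previous bound applied to \<open>sqrt m\<close> gives an explicit rate at which
  \<open>-m ln m\<close> vanishes, so that many cells of tiny mass contribute little.\<close>

lemma neg_mult_ln_le_sqrt:
  fixes m :: real
  assumes "0 \<le> m"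
  shows "- (m * ln m) \<le> 2 * sqrt m"
proof -
  have "- (m * ln m) = 2 * sqrt m * - (sqrt m * ln (sqrt m))"
    using assms by (cases "m = 0") (auto simp: ln_sqrt)
  also have "\<dots> \<le> 2 * sqrt m * 1"
    using assms neg_mult_ln_le_1[of "sqrt m"] by (intro mult_left_mono) auto
  finally show ?thesis by simp
qed

context compact_metrized
begin

lemma finite_borel: "finite (A :: 'b set) \<Longrightarrow> A \<in> sets borel"
  using closedin_Hausdorff_finite[OF Hausdorff_space_mtopology, of A]
  by (simp add: mtopology_eq)

text \<open>The cells about the points of \<open>A\<close> contribute at most 1 each. A single test
  function forces all mass but \<delta> into these cells, and the number of remaining cells depends
  on \<open>e\<close> alone, so \<delta> can be chosen to make their total contribution at most
  1.\<close>

lemma small_entropy_nbhd: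
  fixes \<nu> :: "'b measure"
  assumes \<nu>: "\<nu> \<in> borel_prob_measures euclidean" "AE x in \<nu>. x \<in> A" and A: "finite A"
    and e: "0 < e"
  obtains W where "openin (weak_topology euclidean) W" "\<nu> \<in> W"
    "\<And>\<mu>. \<mu> \<in> W \<Longrightarrow> - (LINT x : msupport euclidean \<mu> | \<mu>. ln (measure \<mu> (mball x e))) \<le> real (card A) + 1"
proof -
  obtain K where K: "finite K" "(\<Union>c\<in>K. mball c (e / 2)) = UNIV"
    using finite_mball_cover[of "e / 2"] e by auto
  define G where "G = (\<Union>a\<in>A. mball a (e / 2))"
  \<comment> \<open>Makes \<open>2 * sqrt \<delta> = 1 / (card K + 1)\<close>, so that
    \<open>card K\<close> cells of mass below \<delta> contribute less than 1.\<close>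
  define \<delta> where "\<delta> = (1 / (2 * (real (card K) + 1)))\<^sup>2"
  have \<delta>: "0 < \<delta>" and sqrt_\<delta>: "sqrt \<delta> = 1 / (2 * (real (card K) + 1))"
    by (simp_all add: \<delta>_def)
  \<comment> \<open>A sum of tents of radius \<open>e / 2\<close>: it equals 1 on \<open>A\<close>
    and vanishes off \<open>G\<close>. The tents may overlap, hence the truncation at 1.\<close>
  define f where "f x = min 1 (\<Sum>a\<in>A. max 0 (1 - 2 / e * d a x))" for x
  have f_cont: "continuous_on UNIV f"
    unfolding f_def[abs_def] by (intro continuous_intros continuous_on_d)
  note f_bdd = bounded_range_continuous[OF f_cont]
  have f_le: "f x \<le> indicator G x" for x
  proof (cases "x \<in> G")
    case False
    then have "max 0 (1 - 2 / e * d a x) = 0" if "a \<in> A" for a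
      using that e by (auto simp: G_def not_less field_simps)
    then show ?thesis
      using False by (simp add: f_def)
  qed (simp add: f_def)
  have f_A: "f x = 1" if "x \<in> A" for x
  proof -
    have "max 0 (1 - 2 / e * d x x) \<le> (\<Sum>a\<in>A. max 0 (1 - 2 / e * d a x))"
      using that A by (intro member_le_sum[of x A "\<lambda>a. max 0 (1 - 2 / e * d a x)"]) auto
    then show ?thesis
      by (simp add: f_def)
  qed
  let ?W = "{\<mu> \<in> borel_prob_measures euclidean. (\<integral>x. f x \<partial>\<mu>) \<in> {1 - \<delta><..}}"
  show ?thesis
  proof (rule that)
    show "openin (weak_topology euclidean) ?W"
      by (intro openin_weak_topology_integral f_cont f_bdd open_greaterThan)
    interpret \<nu>: prob_space \<nu>
      using \<nu> by (simp add: borel_prob_measures_euclidean)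
    have "(\<integral>x. f x \<partial>\<nu>) = (\<integral>x. 1 \<partial>\<nu>)"
    proof (rule integral_cong_AE)
      show "f \<in> borel_measurable \<nu>"
        using integrable_continuous_on_bounded[OF \<nu>(1) f_cont f_bdd] by simp
      show "AE x in \<nu>. f x = 1"
        using \<nu>(2) by (rule eventually_mono) (rule f_A)
    qed simp
    then show "\<nu> \<in> ?W"
      using \<nu> \<delta> by (simp add: \<nu>.prob_space)
    fix \<mu> assume "\<mu> \<in> ?W"
    then have \<mu>: "\<mu> \<in> borel_prob_measures euclidean" "1 - \<delta> < (\<integral>x. f x \<partial>\<mu>)"
      by auto
    then interpret prob_space \<mu>
      by (simp add: borel_prob_measures_euclidean)
    have sets: "sets \<mu> = sets borel"
      using \<mu> by (simp add: borel_prob_measures_euclidean)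
    have G: "G \<in> sets borel"
      using A mball_borel unfolding G_def by (intro sets.finite_UN) auto
    have "(\<integral>x. f x \<partial>\<mu>) \<le> (\<integral>x. indicator G x \<partial>\<mu>)"
      using G sets by (intro integral_mono integrable_continuous_on_bounded[OF \<mu>(1) f_cont f_bdd] f_le)
        (simp add: emeasure_eq_measure)
    then have mG: "1 - measure \<mu> G < \<delta>"
      using \<mu>(2) G sets by simp
    define C where "C = case_sum (\<lambda>a. mball a (e / 2)) (\<lambda>c. mball c (e / 2) - G)"
    have "- (LINT x : msupport euclidean \<mu> | \<mu>. ln (measure \<mu> (mball x e)))
      \<le> (\<Sum>j\<in>A <+> K. - (measure \<mu> (C j) * ln (measure \<mu> (C j))))"
    proof (rule neg_entropy_integral_le[OF \<mu>(1)])
      show "finite (A <+> K)"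
        using A K by simp
      show "C j \<in> sets borel" if "j \<in> A <+> K" for j
        using that mball_borel G by (auto simp: C_def)
      have "x \<in> (\<Union>j\<in>A <+> K. C j)" for x
      proof (cases "x \<in> G")
        case True
        then obtain a where "a \<in> A" "x \<in> C (Inl a)"
          by (auto simp: G_def C_def)
        then show ?thesis by blast
      next
        case False
        moreover have "x \<in> (\<Union>c\<in>K. mball c (e / 2))"
          using K(2) by blast
        ultimately obtain c where "c \<in> K" "x \<in> C (Inr c)"
          by (auto simp: C_def)
        then show ?thesis by blast
      qed
      then show "(\<Union>j\<in>A <+> K. C j) = UNIV"
        by blast
      have "mball c (e / 2) \<subseteq> mball x e" if "x \<in> mball c (e / 2)" for c x
      proof
        fix y assume "y \<in> mball c (e / 2)"
        then show "y \<in> mball x e"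
          using that triangle[of x c y] commute[of x c] by simp
      qed
      then show "C j \<subseteq> mball x e" if "j \<in> A <+> K" "x \<in> C j" for j x
        using that unfolding C_def by (cases j) auto
    qed
    also have "\<dots> = (\<Sum>a\<in>A. - (measure \<mu> (C (Inl a)) * ln (measure \<mu> (C (Inl a)))))
        + (\<Sum>c\<in>K. - (measure \<mu> (C (Inr c)) * ln (measure \<mu> (C (Inr c)))))"
      using A K by (simp add: sum.Plus)
    also have "\<dots> \<le> (\<Sum>a\<in>A. 1) + (\<Sum>c\<in>K. 2 * sqrt \<delta>)"
    proof (intro add_mono sum_mono)
      fix c assume "c \<in> K"
      have "measure \<mu> (C (Inr c)) \<le> measure \<mu> (space \<mu> - G)"
        using G sets mball_borel sets_eq_imp_space_eq[OF sets]
        by (intro finite_measure_mono) (auto simp: C_def)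
      also have "\<dots> = 1 - measure \<mu> G"
        using G sets by (intro prob_compl) simp
      finally have "sqrt (measure \<mu> (C (Inr c))) \<le> sqrt \<delta>"
        using mG by (intro real_sqrt_le_mono) linarith
      then show "- (measure \<mu> (C (Inr c)) * ln (measure \<mu> (C (Inr c)))) \<le> 2 * sqrt \<delta>"
        using neg_mult_ln_le_sqrt[OF measure_nonneg, of \<mu> "C (Inr c)"] by linarith
    qed (rule neg_mult_ln_le_1, simp)
    also have "\<dots> \<le> real (card A) + 1"
      by (simp add: sqrt_\<delta> field_simps)
    finally show "- (LINT x : msupport euclidean \<mu> | \<mu>. ln (measure \<mu> (mball x e))) \<le> real (card A) + 1" .
  qed
qed

text \<open>A weak neighbourhood controls finitely many integrals, but there are infinitely many
  balls. Every ball of radius \<open>e / 2\<close> lies in the ball of radius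
  \<open>3 / 4 * e\<close> about a point of a finite \<open>e / 4\<close>-net, and
  \<open>f c\<close> interpolates between the indicators of the balls of radii
  \<open>3 / 4 * e\<close> and \<open>e\<close> about \<open>c\<close>.\<close>

lemma small_balls_nbhd:
  fixes \<nu> :: "'b measure"
  assumes \<nu>: "\<nu> \<in> borel_prob_measures euclidean" and e: "0 < e"
    and s: "\<And>x. measure \<nu> (mball x e) < s"
  obtains W where "openin (weak_topology euclidean) W" "\<nu> \<in> W"
    "\<And>\<mu> x. \<mu> \<in> W \<Longrightarrow> measure \<mu> (mball x (e / 2)) < s"
proof -
  obtain K where K: "finite K" "(\<Union>c\<in>K. mball c (e / 4)) = UNIV"
    using finite_mball_cover[of "e / 4"] e by auto
  define f where "f c y = max 0 (min 1 (4 - 4 / e * d c y))" for c y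
  have f_cont: "continuous_on UNIV (f c)" for c
    unfolding f_def[abs_def] by (intro continuous_intros continuous_on_d)
  note f_bdd = bounded_range_continuous[OF f_cont]
  have f_le: "f c y \<le> indicator (mball c e) y" for c y
    using e by (auto simp: f_def indicator_def field_simps)
  have f_ge: "indicator (mball c (3 / 4 * e)) y \<le> f c y" for c y
    using e by (auto simp: f_def indicator_def field_simps)
  let ?W = "\<lambda>c. {\<mu> \<in> borel_prob_measures euclidean. (\<integral>x. f c x \<partial>\<mu>) \<in> {..<s}}"
  show ?thesis
  proof (rule that)
    show "openin (weak_topology euclidean) (\<Inter>(?W ` K))"
    proof (rule openin_Inter)
      show "finite (?W ` K)" "?W ` K \<noteq> {}"
        using K by auto
      show "openin (weak_topology euclidean) U" if "U \<in> ?W ` K" for U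
        using that openin_weak_topology_integral[OF f_cont f_bdd open_lessThan] by auto
    qed
    interpret \<nu>: prob_space \<nu>
      using \<nu> by (simp add: borel_prob_measures_euclidean)
    have "(\<integral>x. f c x \<partial>\<nu>) < s" for c
    proof -
      have mb: "mball c e \<in> sets \<nu>"
        using \<nu> mball_borel by (simp add: borel_prob_measures_euclidean)
      then have "(\<integral>x. f c x \<partial>\<nu>) \<le> (\<integral>x. indicator (mball c e) x \<partial>\<nu>)"
        by (intro integral_mono integrable_continuous_on_bounded[OF \<nu> f_cont f_bdd] f_le)
          (simp add: \<nu>.emeasure_eq_measure)
      also have "\<dots> < s"
        using s mb by simp
      finally show ?thesis .
    qed
    then show "\<nu> \<in> \<Inter>(?W ` K)"
      using \<nu> by simp
    fix \<mu> x assume W: "\<mu> \<in> \<Inter>(?W ` K)"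
    have "x \<in> (\<Union>c\<in>K. mball c (e / 4))"
      using K(2) by blast
    then obtain c where c: "c \<in> K" "d c x < e / 4"
      by auto
    have \<mu>: "\<mu> \<in> borel_prob_measures euclidean" "(\<integral>x. f c x \<partial>\<mu>) < s"
      using W c by auto
    then interpret prob_space \<mu>
      by (simp add: borel_prob_measures_euclidean)
    have mb: "mball y r \<in> sets \<mu>" for y r
      using \<mu> mball_borel by (simp add: borel_prob_measures_euclidean)
    have "mball x (e / 2) \<subseteq> mball c (3 / 4 * e)"
    proof
      fix y assume "y \<in> mball x (e / 2)"
      then show "y \<in> mball c (3 / 4 * e)"
        using c(2) triangle[of c x y] by simp
    qed
    then have "measure \<mu> (mball x (e / 2)) \<le> measure \<mu> (mball c (3 / 4 * e))"
      by (intro finite_measure_mono mb)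
    also have "\<dots> = (\<integral>x. indicator (mball c (3 / 4 * e)) x \<partial>\<mu>)"
      using mb by simp
    also have "\<dots> \<le> (\<integral>x. f c x \<partial>\<mu>)"
      using mb by (intro integral_mono integrable_continuous_on_bounded[OF \<mu>(1) f_cont f_bdd] f_ge)
        (simp add: emeasure_eq_measure)
    finally show "measure \<mu> (mball x (e / 2)) < s"
      using \<mu>(2) by linarith
  qed
qed

end

section \<open>Residual sets and neighbourhoods in the weak topology\<close>

text \<open>The interiors of the \<open>G n\<close> serve as the open dense sets, so openness of a
  condition on entropy quotients never has to be proved; an open piece of \<open>G n\<close> meeting
  each \<open>V\<close> is enough.\<close>

lemma residual_inI:
  fixes Y :: "'b topology" and G :: "nat \<Rightarrow> 'b set"
  assumes "A \<subseteq> topspace Y" "(\<Inter>n. G n) \<subseteq> A"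
    and dense: "\<And>n V. openin Y V \<Longrightarrow> V \<noteq> {} \<Longrightarrow> \<exists>W. openin Y W \<and> V \<inter> W \<noteq> {} \<and> W \<subseteq> G n"
  shows "residual_in Y A"
proof -
  have "Y closure_of (Y interior_of G n) = topspace Y" for n
    unfolding dense_intersects_open
  proof (intro allI impI)
    fix V assume "openin Y V \<and> V \<noteq> {}"
    then obtain W where W: "openin Y W" "V \<inter> W \<noteq> {}" "W \<subseteq> G n"
      using dense[of V n] by auto
    then have "W \<subseteq> Y interior_of G n"
      by (intro interior_of_maximal)
    then show "Y interior_of G n \<inter> V \<noteq> {}"
      using W(2) by auto
  qed
  moreover have "(\<Inter>n. Y interior_of G n) \<subseteq> A"
    using interior_of_subset[of Y] by (intro subset_trans[OF INF_mono' assms(2)])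
  ultimately show ?thesis
    unfolding residual_in_def using assms(1) openin_interior_of[of Y]
    by (intro conjI exI[of _ "\<lambda>n. Y interior_of G n"]) simp_all
qed

text \<open>Induction over the generated topology; at an intersection the test functions are united
  and the smaller tolerance is kept.\<close>

lemma weak_topology_nbhd:
  fixes Y :: "'b topology"
  assumes V: "openin (weak_topology Y) V" "\<mu> \<in> V"
  obtains F \<eta> where "finite F" "0 < \<eta>"
    "\<And>f. f \<in> F \<Longrightarrow> continuous_map Y euclideanreal f \<and> bounded (f ` topspace Y)"
    "{\<nu> \<in> borel_prob_measures Y. \<forall>f\<in>F. \<bar>(\<integral>x. f x \<partial>\<nu>) - (\<integral>x. f x \<partial>\<mu>)\<bar> < \<eta>} \<subseteq> V"
proof -
  define C where "C = {f. continuous_map Y euclideanreal f \<and> bounded (f ` topspace Y)}"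
  define N where "N F \<eta> = {\<nu> \<in> borel_prob_measures Y. \<forall>f\<in>F. \<bar>(\<integral>x. f x \<partial>\<nu>) - (\<integral>x. f x \<partial>\<mu>)\<bar> < \<eta>}" for F :: "('b \<Rightarrow> real) set" and \<eta>
  let ?P = "\<lambda>V. \<exists>F \<eta>. finite F \<and> F \<subseteq> C \<and> 0 < \<eta> \<and> N F \<eta> \<subseteq> V"
  have "\<mu> \<in> V \<longrightarrow> ?P V"
    if "generate_topology_on {{\<mu> \<in> borel_prob_measures Y. (\<integral>x. f x \<partial>\<mu>) \<in> V} | f V.
        continuous_map Y euclideanreal f \<and> bounded (f ` topspace Y) \<and> open V} V" for V
    using that
  proof (induction rule: generate_topology_on.induct)
    case (Int a b)
    show ?case
    proof
      assume "\<mu> \<in> a \<inter> b"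
      then obtain F \<eta> F' \<eta>' where F: "finite F" "F \<subseteq> C" "0 < \<eta>" "N F \<eta> \<subseteq> a"
        and F': "finite F'" "F' \<subseteq> C" "0 < \<eta>'" "N F' \<eta>' \<subseteq> b"
        using Int.IH by auto
      have "N (F \<union> F') (min \<eta> \<eta>') \<subseteq> N F \<eta> \<inter> N F' \<eta>'"
        by (auto simp: N_def)
      then have "N (F \<union> F') (min \<eta> \<eta>') \<subseteq> a \<inter> b"
        using F(4) F'(4) by blast
      moreover have "finite (F \<union> F')" "F \<union> F' \<subseteq> C" "0 < min \<eta> \<eta>'"
        using F F' by simp_all
      ultimately show "?P (a \<inter> b)" by meson
    qed
  next
    case (UN K)
    show ?case
    proof
      assume "\<mu> \<in> \<Union>K"
      then obtain k where k: "k \<in> K" "\<mu> \<in> k" by (rule UnionE)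
      then obtain F \<eta> where F: "finite F" "F \<subseteq> C" "0 < \<eta>" "N F \<eta> \<subseteq> k"
        using UN.IH[OF k(1)] by meson
      have "N F \<eta> \<subseteq> \<Union>K"
        using F(4) k(1) by (meson Union_upper order_trans)
      with F show "?P (\<Union>K)" by meson
    qed
  next
    case (Basis s)
    then obtain f U where s: "s = {\<mu> \<in> borel_prob_measures Y. (\<integral>x. f x \<partial>\<mu>) \<in> U}"
      and f: "f \<in> C" and U: "open U"
      unfolding C_def by blast
    show ?case
    proof
      assume "\<mu> \<in> s"
      then obtain \<eta> where \<eta>: "0 < \<eta>" "ball (\<integral>x. f x \<partial>\<mu>) \<eta> \<subseteq> U"
        using U unfolding s by (metis (no_types, lifting) mem_Collect_eq openE)
      then have "N {f} \<eta> \<subseteq> s"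
        by (auto simp: N_def s dist_real_def abs_minus_commute)
      then show "?P s"
        using f \<eta>(1) by (intro exI[of _ "{f}"] exI[of _ \<eta>]) auto
    qed
  qed simp
  from this[of V] obtain F \<eta> where "finite F" "F \<subseteq> C" "0 < \<eta>" "N F \<eta> \<subseteq> V"
    using V unfolding weak_topology_def openin_topology_generated_by_iff by meson
  then show ?thesis
    by (intro that[of F \<eta>]) (auto simp: N_def C_def)
qed

section \<open>Measures on periodic orbits\<close>

text \<open>Times rather than points are weighted uniformly, so \<open>P\<close> may be any multiple
  of the minimal period and masses are obtained by counting times.\<close>

definition orbit_measure :: "('b::topological_space \<Rightarrow> 'b) \<Rightarrow> 'b \<Rightarrow> nat \<Rightarrow> 'b measure" where
  "orbit_measure T z P = distr (uniform_count_measure {..<P}) borel (\<lambda>i. (T ^^ i) z)"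

context
  fixes T :: "'b::topological_space \<Rightarrow> 'b" and z :: 'b and P :: nat
  assumes P: "0 < P"
begin

lemma measurable_orbit: "(\<lambda>i. (T ^^ i) z) \<in> measurable (uniform_count_measure {..<P}) borel"
  by (auto simp: measurable_def sets_uniform_count_measure space_uniform_count_measure)

lemma orbit_measure_in: "orbit_measure T z P \<in> borel_prob_measures euclidean"
  using P prob_space.prob_space_distr[OF prob_space_uniform_count_measure measurable_orbit]
  by (auto simp: borel_prob_measures_euclidean orbit_measure_def)

lemma integral_orbit_measure:
  fixes f :: "'b \<Rightarrow> real"
  assumes "f \<in> borel_measurable borel"
  shows "(\<integral>x. f x \<partial>orbit_measure T z P) = (\<Sum>i<P. f ((T ^^ i) z)) / P"
  using assms unfolding orbit_measure_def
  by (subst integral_distr[OF measurable_orbit]) (auto simp: integral_uniform_count_measure)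

lemma measure_orbit_measure:
  assumes "S \<in> sets borel"
  shows "measure (orbit_measure T z P) S = card {i. i < P \<and> (T ^^ i) z \<in> S} / P"
proof -
  interpret prob_space "orbit_measure T z P"
    using orbit_measure_in by (simp add: borel_prob_measures_euclidean)
  have "measure (orbit_measure T z P) S = (\<integral>x. indicator S x \<partial>orbit_measure T z P)"
    using assms by (simp add: orbit_measure_def)
  also have "\<dots> = (\<Sum>i<P. indicator S ((T ^^ i) z)) / P"
    using assms by (intro integral_orbit_measure) simp
  also have "(\<Sum>i<P. indicator S ((T ^^ i) z)) = real (card {i. i < P \<and> (T ^^ i) z \<in> S})"
    by (simp add: indicator_def sum.If_cases Int_def)
  finally show ?thesis .
qed

lemma AE_orbit_measure:
  assumes "S \<in> sets borel" "\<And>i. i < P \<Longrightarrow> (T ^^ i) z \<in> S"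
  shows "AE x in orbit_measure T z P. x \<in> S"
  using assms unfolding orbit_measure_def
  by (subst AE_distr_iff[OF measurable_orbit]) (auto simp: space_uniform_count_measure)

lemma orbit_measure_invariant:
  assumes T: "continuous_on UNIV T" and z: "(T ^^ P) z = z"
  shows "orbit_measure T z P \<in> invariant_measures euclidean T"
proof -
  let ?\<nu> = "orbit_measure T z P"
  interpret prob_space ?\<nu>
    using orbit_measure_in by (simp add: borel_prob_measures_euclidean)
  have sets: "sets ?\<nu> = sets borel"
    by (simp add: orbit_measure_def)
  have T_meas: "T \<in> measurable borel borel"
    using T by (rule borel_measurable_continuous_onI)
  then have T_meas': "T \<in> measurable ?\<nu> ?\<nu>"
    by (simp add: measurable_cong_sets[OF sets sets])
  interpret D: prob_space "distr ?\<nu> ?\<nu> T"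
    using T_meas' by (rule prob_space_distr)
  have inv: "distr ?\<nu> ?\<nu> T = ?\<nu>"
  proof (rule measure_eqI)
    fix S assume "S \<in> sets (distr ?\<nu> ?\<nu> T)"
    then have S: "S \<in> sets borel"
      by (simp add: sets)
    have "measure (distr ?\<nu> ?\<nu> T) S = (\<integral>x. indicator S x \<partial>distr ?\<nu> ?\<nu> T)"
      using S by (simp add: sets)
    also have "\<dots> = (\<integral>x. indicator S (T x) \<partial>?\<nu>)"
      using S sets by (intro integral_distr T_meas') simp
    also have "\<dots> = (\<Sum>i<P. indicator S ((T ^^ Suc i) z)) / P"
      using S T_meas by (subst integral_orbit_measure) auto
    \<comment> \<open>Periodicity: the term gained at \<open>P\<close> equals the term lost at
      0.\<close>
    also have "(\<Sum>i<P. indicator S ((T ^^ Suc i) z)) = ((\<Sum>i<P. indicator S ((T ^^ i) z)) :: real)"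
      using sum.lessThan_Suc[of "\<lambda>i. indicator S ((T ^^ i) z) :: real" P]
        sum.lessThan_Suc_shift[of "\<lambda>i. indicator S ((T ^^ i) z) :: real" P] z by simp
    also have "\<dots> / P = (\<integral>x. indicator S x \<partial>?\<nu>)"
      using S by (subst integral_orbit_measure) auto
    also have "\<dots> = measure ?\<nu> S"
      using S by (simp add: sets)
    finally show "emeasure (distr ?\<nu> ?\<nu> T) S = emeasure ?\<nu> S"
      by (simp add: D.emeasure_eq_measure emeasure_eq_measure)
  qed simp
  show ?thesis
    unfolding invariant_measures_def by (intro CollectI conjI orbit_measure_in T_meas' inv)
qed

end

section \<open>Approximating invariant measures of the full shift\<close>

text \<open>If the vectors \<open>h(x\<^sub>j) - \<integral>h d\<mu>\<close> chosen so far sum to \<open>S\<close>, the function \<open>\<langle>S, h(x) - \<integral>h d\<mu>\<rangle>\<close>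
  has integral 0, so some \<open>x\<close> makes it nonpositive; adding that \<open>x\<close> keeps \<open>|S|\<^sup>2\<close> linear in the
  number of points.\<close>

lemma (in prob_space) ex_points_average_near_expectation:
  fixes F :: "('a \<Rightarrow> real) set"
  assumes F: "finite F" "\<And>f. f \<in> F \<Longrightarrow> integrable M f" "\<And>f x. f \<in> F \<Longrightarrow> \<bar>f x\<bar> \<le> B"
    and \<eta>: "0 < \<eta>"
  obtains m xs where "0 < m" "\<And>f. f \<in> F \<Longrightarrow> \<bar>(\<Sum>j<m. f (xs j)) / real m - expectation f\<bar> < \<eta>"
proof -
  define h where "h f x = f x - expectation f" for f :: "'a \<Rightarrow> real" and x
  have B: "\<bar>h f x\<bar> \<le> 2 * B" if "f \<in> F" for f x
  proof -
    have "\<bar>expectation f\<bar> \<le> expectation (\<lambda>x. \<bar>f x\<bar>)"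
      using integral_norm_bound[of M f] by simp
    also have "\<dots> \<le> expectation (\<lambda>x. B)"
      using F that by (intro integral_mono) auto
    finally have "\<bar>expectation f\<bar> \<le> B"
      by (simp add: prob_space)
    then show ?thesis
      using F(3)[OF that, of x] by (simp add: h_def)
  qed
  \<comment> \<open>Bounds the squared length of every single vector \<open>h f x\<close>, hence the
    growth of the squared length of the sum per added point.\<close>
  define D where "D = real (card F) * (2 * B)\<^sup>2"
  have "\<exists>xs. (\<Sum>f\<in>F. (\<Sum>j<m. h f (xs j))\<^sup>2) \<le> real m * D" for m
  proof (induction m)
    case (Suc m)
    then obtain xs where xs: "(\<Sum>f\<in>F. (\<Sum>j<m. h f (xs j))\<^sup>2) \<le> real m * D"
      by blast
    define S where "S f = (\<Sum>j<m. h f (xs j))" for f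
    have int: "integrable M (\<lambda>x. \<Sum>f\<in>F. S f * h f x)"
      using F by (auto simp: h_def)
    have "expectation (\<lambda>x. \<Sum>f\<in>F. S f * h f x) = (\<Sum>f\<in>F. S f * expectation (h f))"
      using F by (subst Bochner_Integration.integral_sum) (auto simp: h_def[abs_def])
    also have "\<dots> = 0"
      using F by (intro sum.neutral) (auto simp: h_def[abs_def] prob_space)
    finally have 0: "expectation (\<lambda>x. \<Sum>f\<in>F. S f * h f x) = 0" .
    obtain x where x: "(\<Sum>f\<in>F. S f * h f x) \<le> 0"
    \<comment> \<open>A strictly positive function cannot have integral 0 against a probability
      measure.\<close>
    proof (rule ccontr)
      assume "\<not> thesis"
      then have pos: "0 < (\<Sum>f\<in>F. S f * h f x)" for x
        using that by (meson not_less)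
      then have "AE x in M. (\<Sum>f\<in>F. S f * h f x) = 0"
        using 0 int by (subst integral_nonneg_eq_0_iff_AE[symmetric]) (auto intro: less_imp_le)
      then have "AE x in M. False"
        by (rule eventually_mono) (metis pos less_irrefl)
      then show False
        by simp
    qed
    have "(\<Sum>f\<in>F. (\<Sum>j<Suc m. h f ((xs(m := x)) j))\<^sup>2) = (\<Sum>f\<in>F. (S f + h f x)\<^sup>2)"
      by (simp add: S_def)
    also have "\<dots> = (\<Sum>f\<in>F. (S f)\<^sup>2) + 2 * (\<Sum>f\<in>F. S f * h f x) + (\<Sum>f\<in>F. (h f x)\<^sup>2)"
      by (simp add: power2_sum sum.distrib sum_distrib_left algebra_simps)
    also have "\<dots> \<le> real m * D + 2 * 0 + (\<Sum>f\<in>F. (2 * B)\<^sup>2)"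
      using xs x B by (intro add_mono mult_left_mono sum_mono abs_le_square_iff[THEN iffD1])
        (auto simp: S_def intro: order_trans[OF _ abs_ge_self])
    also have "\<dots> = real (Suc m) * D"
      by (simp add: D_def algebra_simps)
    finally show ?case by blast
  qed simp
  then obtain X where X: "\<And>m. (\<Sum>f\<in>F. (\<Sum>j<m. h f (X m j))\<^sup>2) \<le> real m * D"
    by metis
  \<comment> \<open>The sum has length at most \<open>sqrt (m * D)\<close>, so the average is below
    \<eta> once \<open>m\<close> exceeds this bound.\<close>
  obtain m where m: "D / \<eta>\<^sup>2 < real m"
    using reals_Archimedean2 by blast
  have "0 \<le> D / \<eta>\<^sup>2"
    by (simp add: D_def)
  then have m0: "0 < m"
    using m by linarith
  show ?thesis
  proof (rule that[OF m0])
    fix f assume f: "f \<in> F"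
    let ?S = "\<Sum>j<m. h f (X m j)"
    have "?S\<^sup>2 \<le> (\<Sum>f\<in>F. (\<Sum>j<m. h f (X m j))\<^sup>2)"
      using f F(1) by (intro member_le_sum[of f F "\<lambda>f. (\<Sum>j<m. h f (X m j))\<^sup>2"]) auto
    also have "\<dots> \<le> real m * D" by (rule X)
    also have "\<dots> < real m * (real m * \<eta>\<^sup>2)"
      using m m0 \<eta> by (simp add: field_simps)
    also have "\<dots> = (real m * \<eta>)\<^sup>2"
      by (simp add: power2_eq_square)
    finally have "\<bar>?S\<bar> < real m * \<eta>"
      using \<eta> by (metis abs_le_square_iff abs_of_nonneg mult_nonneg_nonneg of_nat_0_le_iff less_imp_le not_less)
    moreover have "(\<Sum>j<m. f (X m j)) / real m - expectation f = ?S / real m"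
      using m0 by (simp add: h_def sum_subtractf field_simps)
    ultimately show "\<bar>(\<Sum>j<m. f (X m j)) / real m - expectation f\<bar> < \<eta>"
      using m0 by (simp add: abs_divide field_simps)
  qed
qed

text \<open>By compactness finitely many open cylinders, on each of which \<open>f\<close> stays
  within \<open>\<eta> / 2\<close> of its value at a reference point, cover the space. Points
  agreeing on the coordinates that these cylinders restrict lie in a common cylinder.\<close>

lemma continuous_on_fun_finite_coordinates:
  fixes f :: "('i \<Rightarrow> 'a::topological_space) \<Rightarrow> real"
  assumes compact: "compact (UNIV :: 'a set)" and f: "continuous_on UNIV f" and \<eta>: "0 < \<eta>"
  obtains I where "finite I" "\<And>x y. (\<And>i. i \<in> I \<Longrightarrow> x i = y i) \<Longrightarrow> \<bar>f x - f y\<bar> < \<eta>"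
proof -
  have "\<exists>X. x \<in> Pi UNIV X \<and> (\<forall>i. open (X i)) \<and> finite {i. X i \<noteq> UNIV}
      \<and> (\<forall>y\<in>Pi UNIV X. \<bar>f y - f x\<bar> < \<eta> / 2)" for x
  proof -
    have "open {y. \<bar>f y - f x\<bar> < \<eta> / 2}"
      by (intro open_Collect_less continuous_intros f)
    then have "openin (product_topology (\<lambda>_. euclidean) UNIV) {y. \<bar>f y - f x\<bar> < \<eta> / 2}"
      by (simp add: euclidean_product_topology)
    from product_topology_open_contains_basis[OF this, of x] \<eta>
    show ?thesis
      by (auto simp: PiE_UNIV_domain subset_iff)
  qed
  then have "\<exists>X. \<forall>x. x \<in> Pi UNIV (X x) \<and> (\<forall>i. open (X x i)) \<and> finite {i. X x i \<noteq> UNIV}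
      \<and> (\<forall>y\<in>Pi UNIV (X x). \<bar>f y - f x\<bar> < \<eta> / 2)"
    by (intro choice allI)
  then obtain X where X0: "\<forall>x. x \<in> Pi UNIV (X x) \<and> (\<forall>i. open (X x i)) \<and> finite {i. X x i \<noteq> UNIV}
      \<and> (\<forall>y\<in>Pi UNIV (X x). \<bar>f y - f x\<bar> < \<eta> / 2)"
    by (rule exE)
  have X: "x \<in> Pi UNIV (X x)" "open (X x i)" "finite {i. X x i \<noteq> UNIV}"
      "y \<in> Pi UNIV (X x) \<Longrightarrow> \<bar>f y - f x\<bar> < \<eta> / 2" for x y i
    using spec[OF X0, of x] by auto
  obtain C where C: "finite C" "UNIV \<subseteq> (\<Union>x\<in>C. Pi UNIV (X x))"
  proof (rule compactE_image[OF compact_UNIV_fun[OF compact], of UNIV "\<lambda>x. Pi UNIV (X x)"])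
    show "open (Pi UNIV (X x))" for x
      using open_PiE[OF X(2,3)] by (simp add: PiE_UNIV_domain)
    show "UNIV \<subseteq> (\<Union>x\<in>UNIV. Pi UNIV (X x))"
      using X(1) by blast
  qed
  show ?thesis
  proof (rule that)
    show "finite (\<Union>x\<in>C. {i. X x i \<noteq> UNIV})"
      using C(1) X(3) by blast
    fix x y :: "'i \<Rightarrow> 'a" assume eq: "\<And>i. i \<in> (\<Union>x\<in>C. {i. X x i \<noteq> UNIV}) \<Longrightarrow> x i = y i"
    obtain c where c: "c \<in> C" "x \<in> Pi UNIV (X c)"
      using C(2) by blast
    have "y i \<in> X c i" for i
    proof (cases "X c i = UNIV")
      case False
      then have "x i = y i"
        using c(1) by (intro eq) blast
      moreover have "x i \<in> X c i"
        using c(2) by (rule Pi_mem) simp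
      ultimately show ?thesis by simp
    qed simp
    then have "y \<in> Pi UNIV (X c)"
      by auto
    then show "\<bar>f x - f y\<bar> < \<eta>"
      using X(4)[OF c(2)] X(4)[of y c] by linarith
  qed
qed

lemma full_shift_funpow: "(full_shift ^^ i) z = (\<lambda>u. z (u - int i))"
  by (induction i) (auto simp: full_shift_def fun_eq_iff algebra_simps)

lemma sum_lessThan_mult:
  fixes f :: "nat \<Rightarrow> 'a::comm_monoid_add"
  shows "(\<Sum>i<a * b. f i) = (\<Sum>q<a. \<Sum>s<b. f (q * b + s))"
proof -
  have "(\<Sum>i<a * b. f i) = (\<Sum>q<a. sum f {q * b..<q * b + b})"
    by (rule sum.nat_group[symmetric])
  also have "\<dots> = (\<Sum>q<a. \<Sum>s<b. f (q * b + s))"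
  proof (rule sum.cong[OF refl])
    show "sum f {q * b..<q * b + b} = (\<Sum>s<b. f (q * b + s))" for q
      using sum.shift_bounds_nat_ivl[of f 0 "q * b" b] by (simp add: atLeast0LessThan add.commute)
  qed
  finally show ?thesis .
qed

lemma integral_funpow_invariant:
  fixes f :: "'b::topological_space \<Rightarrow> real"
  assumes \<mu>: "\<mu> \<in> invariant_measures euclidean T" and f: "f \<in> borel_measurable borel"
  shows "(\<lambda>x. f ((T ^^ s) x)) \<in> borel_measurable \<mu>" "(\<integral>x. f ((T ^^ s) x) \<partial>\<mu>) = (\<integral>x. f x \<partial>\<mu>)"
proof -
  have sets: "sets \<mu> = sets borel" and T: "T \<in> measurable \<mu> \<mu>" and inv: "distr \<mu> \<mu> T = \<mu>"
    using \<mu> by (simp_all add: invariant_measures_def borel_prob_measures_euclidean)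
  have f': "f \<in> borel_measurable \<mu>"
    using f by (simp add: measurable_cong_sets[OF sets refl])
  have Ts: "T ^^ s \<in> measurable \<mu> \<mu>" for s
    using T by (induction s) (auto simp: measurable_comp)
  show meas: "(\<lambda>x. f ((T ^^ s) x)) \<in> borel_measurable \<mu>" for s
    using measurable_compose[OF Ts f'] .
  show "(\<integral>x. f ((T ^^ s) x) \<partial>\<mu>) = (\<integral>x. f x \<partial>\<mu>)"
  proof (induction s)
    case (Suc s)
    have "(\<integral>x. f ((T ^^ s) x) \<partial>\<mu>) = (\<integral>x. f ((T ^^ s) x) \<partial>distr \<mu> \<mu> T)"
      by (simp only: inv)
    also have "\<dots> = (\<integral>x. f ((T ^^ s) (T x)) \<partial>\<mu>)"
      by (rule integral_distr[OF T meas])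
    finally show ?case
      using Suc by (simp add: funpow_swap1)
  qed simp
qed

text \<open>The word \<open>w\<close> lists \<open>N\<close> consecutive symbols of each of finitely many points whose empirical measure
  is close to \<open>\<mu>\<close> on the Birkhoff averages of length \<open>N\<close>. One symbol per period is left free:
  it is used to create entropy.\<close>

lemma periodic_word_approximation:
  fixes \<mu> :: "(int \<Rightarrow> 'm::topological_space) measure"
  assumes compact: "compact (UNIV :: 'm set)"
    and \<mu>: "\<mu> \<in> invariant_measures euclidean full_shift"
    and F: "finite F" "\<And>f. f \<in> F \<Longrightarrow> continuous_on UNIV f" and \<eta>: "0 < \<eta>"
  obtains p w where "0 < p" "\<And>u. w (u + int p) = w u"
    "\<And>z Q f. 0 < Q \<Longrightarrow> (\<And>u. \<not> int p dvd u \<Longrightarrow> z u = w u) \<Longrightarrow> f \<in> F \<Longrightarrow>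
       \<bar>(\<Sum>i<Q * p. f ((full_shift ^^ i) z)) / real (Q * p) - (\<integral>x. f x \<partial>\<mu>)\<bar> < \<eta>"
proof -
  let ?T = "full_shift :: (int \<Rightarrow> 'm) \<Rightarrow> _"
  have bpm: "\<mu> \<in> borel_prob_measures euclidean"
    using \<mu> by (simp add: invariant_measures_def)
  then interpret prob_space \<mu>
    by (simp add: borel_prob_measures_euclidean)
  have "\<exists>b. \<forall>x. \<bar>f x\<bar> \<le> b" if "f \<in> F" for f
    using compact_imp_bounded[OF compact_continuous_image[OF F(2)[OF that] compact_UNIV_fun[OF compact]]]
    by (auto simp: bounded_iff)
  then obtain b where b: "\<And>f x. f \<in> F \<Longrightarrow> \<bar>f x\<bar> \<le> b f"
    by metis
  define B where "B = 1 + (\<Sum>f\<in>F. \<bar>b f\<bar>)"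
  have B0: "0 < B"
    unfolding B_def by (intro add_pos_nonneg sum_nonneg) auto
  have B: "\<bar>f x\<bar> \<le> B" if "f \<in> F" for f x
    using b[OF that, of x] member_le_sum[of f F "\<lambda>f. \<bar>b f\<bar>"] that F(1) by (simp add: B_def)
  have "\<forall>f\<in>F. \<exists>I. finite I \<and> (\<forall>x y. (\<forall>i\<in>I. x i = y i) \<longrightarrow> \<bar>f x - f y\<bar> < \<eta> / 3)"
  proof
    fix f assume f: "f \<in> F"
    obtain I where I: "finite I" "\<And>x y. (\<And>i. i \<in> I \<Longrightarrow> x i = y i) \<Longrightarrow> \<bar>f x - f y\<bar> < \<eta> / 3"
      using continuous_on_fun_finite_coordinates[OF compact F(2)[OF f], of "\<eta> / 3"] \<eta> by auto
    then show "\<exists>I. finite I \<and> (\<forall>x y. (\<forall>i\<in>I. x i = y i) \<longrightarrow> \<bar>f x - f y\<bar> < \<eta> / 3)"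
      by (intro exI[of _ I] conjI allI impI I) (rule bspec)
  qed
  from bchoice[OF this] obtain I where I0: "\<forall>f\<in>F. finite (I f) \<and> (\<forall>x y. (\<forall>i\<in>I f. x i = y i) \<longrightarrow> \<bar>f x - f y\<bar> < \<eta> / 3)"
    by (rule exE)
  have I: "finite (I f)" "(\<forall>i\<in>I f. x i = y i) \<Longrightarrow> \<bar>f x - f y\<bar> < \<eta> / 3" if "f \<in> F" for f x y
    using bspec[OF I0 that] by auto
  have "finite ((\<lambda>i. nat \<bar>i\<bar>) ` (\<Union>f\<in>F. I f))"
    using F(1) I(1) by blast
  then obtain L where L0: "\<forall>l\<in>(\<lambda>i. nat \<bar>i\<bar>) ` (\<Union>f\<in>F. I f). l \<le> L"
    unfolding finite_nat_set_iff_bounded_le by blast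
  have L: "\<bar>f x - f y\<bar> < \<eta> / 3" if f: "f \<in> F" and eq: "\<And>t. \<bar>t\<bar> \<le> int L \<Longrightarrow> x t = y t" for f x y
  proof (rule I(2)[OF f], rule ballI)
    fix i assume "i \<in> I f"
    then have "nat \<bar>i\<bar> \<le> L"
      using L0 f by blast
    then show "x i = y i"
      by (intro eq) linarith
  qed
  \<comment> \<open>Each piece of length \<open>N\<close> has at most \<open>2 * L + 1\<close>
    places near its ends, each with an error of at most \<open>2 * B\<close>; their total must stay
    below \<open>N * \<eta> / 3\<close>.\<close>
  obtain N where N: "6 * B * (2 * real L + 1) / \<eta> < real N"
    using reals_Archimedean2 by blast
  have "0 \<le> 6 * B * (2 * real L + 1) / \<eta>"
    using B0 \<eta> by simp
  then have N0: "0 < N"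
    using N by linarith
  \<comment> \<open>A sampled point contributes \<open>N\<close> successive shifts, so sampling has
    to be done for Birkhoff averages; invariance of \<mu> gives them the same expectation as
    \<open>f\<close>.\<close>
  define g where "g f x = (\<Sum>s<N. f ((?T ^^ s) x)) / real N" for f x
  have f_meas: "f \<in> borel_measurable borel" if "f \<in> F" for f
    using F(2)[OF that] by (rule borel_measurable_continuous_onI)
  have f_int: "integrable \<mu> (\<lambda>x. f ((?T ^^ s) x))" if "f \<in> F" for f s
    using B[OF that] integral_funpow_invariant(1)[OF \<mu> f_meas[OF that]]
    by (intro integrable_const_bound[of _ B]) auto
  have g_int: "integrable \<mu> (g f)" "expectation (g f) = expectation f" if "f \<in> F" for f
    using f_int[OF that] integral_funpow_invariant(2)[OF \<mu> f_meas[OF that]] N0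
    by (simp_all add: g_def[abs_def] Bochner_Integration.integral_sum)
  have g_B: "\<bar>g f x\<bar> \<le> B" if "f \<in> F" for f x
  proof -
    have "\<bar>\<Sum>s<N. f ((?T ^^ s) x)\<bar> \<le> (\<Sum>s<N. B)"
      using B[OF that] by (intro order_trans[OF sum_abs] sum_mono)
    then show ?thesis
      using N0 by (simp add: g_def abs_divide field_simps)
  qed
  obtain m xs where m0: "0 < m"
    and xs: "\<And>f. f \<in> F \<Longrightarrow> \<bar>(\<Sum>j<m. g f (xs j)) / real m - expectation f\<bar> < \<eta> / 3"
  proof (rule ex_points_average_near_expectation[of "g ` F" B "\<eta> / 3"])
    fix m xs
    assume "0 < m" "\<And>f. f \<in> g ` F \<Longrightarrow> \<bar>(\<Sum>j<m. f (xs j)) / real m - expectation f\<bar> < \<eta> / 3"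
    then show ?thesis
      using that[of m xs] g_int(2) by force
  qed (use F(1) g_int(1) g_B \<eta> in auto)
  define p where "p = m * N"
  \<comment> \<open>Since \<open>i\<close> shifts bring coordinate \<open>t - i\<close> to
    \<open>t\<close>, the pieces are laid out towards negative coordinates:
    \<open>- (j * N + r)\<close> carries the symbol of \<open>xs j\<close> at
    \<open>- r\<close>.\<close>
  define w where "w u = (let v = nat ((- u) mod int p) in xs (v div N) (- int (v mod N)))" for u
  have p0: "0 < p"
    using m0 N0 by (simp add: p_def)
  show ?thesis
  proof (rule that[OF p0])
    show "w (u + int p) = w u" for u
    proof -
      have "(- (u + int p)) mod int p = (- u) mod int p"
        using mod_mult_self1[of "- u" "- 1" "int p"] by simp
      then show ?thesis
        by (simp add: w_def)
    qed
    fix z and Q :: nat and f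
    assume Q0: "0 < Q" and z: "\<And>u. \<not> int p dvd u \<Longrightarrow> z u = w u" and f: "f \<in> F"
    \<comment> \<open>For other \<open>s\<close> and \<open>\<bar>t\<bar> \<le> L\<close> the
      position \<open>s - t\<close> lies strictly between 0 and \<open>N\<close>. Excluding 0, hence
      \<open>s \<le> L\<close> instead of \<open>s < L\<close>, keeps the window away from the free
      symbols.\<close>
    define bad where "bad s = (s \<le> L \<or> N \<le> s + L)" for s
    have good: "(?T ^^ (q * p + (j * N + s))) z t = (?T ^^ s) (xs j) t"
      if "j < m" "s < N" "\<not> bad s" "\<bar>t\<bar> \<le> int L" for q j s t
    proof -
      define r where "r = nat (int s - t)"
      have r: "0 < r" "r < N" "int r = int s - t"
        using that by (auto simp: r_def bad_def)
      let ?u = "t - int (q * p + (j * N + s))"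
      have v: "j * N + r < p"
      proof -
        have "j * N + r < Suc j * N"
          using r(2) by simp
        also have "\<dots> \<le> p"
          unfolding p_def using that(1) by (intro mult_le_mono1) simp
        finally show ?thesis .
      qed
      have "(- ?u) = int (j * N + r) + int q * int p"
        using r(3) by simp
      then have mod: "(- ?u) mod int p = int (j * N + r)"
        using v by (simp del: of_nat_add of_nat_mult)
      then have "\<not> int p dvd ?u"
        using r(1) by (metis dvd_minus_iff dvd_imp_mod_0 of_nat_eq_0_iff add_is_0 not_gr_zero)
      then have "z ?u = w ?u"
        by (rule z)
      also have "\<dots> = xs j (- int r)"
        using r N0 unfolding w_def mod by (simp add: Let_def del: of_nat_add of_nat_mult)
      also have "\<dots> = xs j (t - int s)"
        using r(3) by simp
      finally show ?thesis
        by (simp add: full_shift_funpow)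
    qed
    have close: "\<bar>f ((?T ^^ (q * p + (j * N + s))) z) - f ((?T ^^ s) (xs j))\<bar>
        \<le> \<eta> / 3 + (if bad s then 2 * B else 0)" if "j < m" "s < N" for q j s
    proof (cases "bad s")
      case True
      then show ?thesis
        using B[OF f, of "(?T ^^ (q * p + (j * N + s))) z"] B[OF f, of "(?T ^^ s) (xs j)"] \<eta> by simp
    next
      case False
      then show ?thesis
        using L[OF f good[OF that False]] by (simp add: less_imp_le)
    qed
    have "card {s. s < N \<and> bad s} \<le> card ({..L} \<union> {N - L..<N})"
      by (intro card_mono) (auto simp: bad_def)
    also have "\<dots> \<le> card {..L} + card {N - L..<N}"
      by (rule card_Un_le)
    also have "\<dots> \<le> 2 * L + 1" by simp
    finally have card: "card {s. s < N \<and> bad s} \<le> 2 * L + 1" .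
    have "(\<Sum>s<N. if bad s then 2 * B else 0) = 2 * B * card {s. s < N \<and> bad s}"
      by (simp add: sum.If_cases Int_def)
    also have "\<dots> \<le> 2 * B * real (2 * L + 1)"
      using card B0 by (intro mult_left_mono) auto
    also have "\<dots> \<le> real N * (\<eta> / 3)"
      using N \<eta> by (simp add: field_simps)
    finally have bad_sum: "(\<Sum>s<N. if bad s then 2 * B else 0) \<le> real N * (\<eta> / 3)" .
    let ?A = "\<Sum>i<Q * p. f ((?T ^^ i) z)" and ?G = "\<Sum>j<m. g f (xs j)"
    have A: "?A = (\<Sum>q<Q. \<Sum>j<m. \<Sum>s<N. f ((?T ^^ (q * p + (j * N + s))) z))"
      by (simp add: sum_lessThan_mult p_def)
    have G: "real Q * (real N * ?G) = (\<Sum>q<Q. \<Sum>j<m. \<Sum>s<N. f ((?T ^^ s) (xs j)))"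
      using N0 by (simp add: g_def sum_divide_distrib[symmetric])
    have "\<bar>?A - real Q * (real N * ?G)\<bar>
        = \<bar>\<Sum>q<Q. \<Sum>j<m. \<Sum>s<N. f ((?T ^^ (q * p + (j * N + s))) z) - f ((?T ^^ s) (xs j))\<bar>"
      by (simp only: A G sum_subtractf)
    also have "\<dots> \<le> (\<Sum>q<Q. \<Sum>j<m. \<Sum>s<N. \<eta> / 3 + (if bad s then 2 * B else 0))"
      by (intro order_trans[OF sum_abs] sum_mono close) auto
    also have "\<dots> \<le> (\<Sum>q<Q. \<Sum>j<m. real N * (\<eta> / 3) + real N * (\<eta> / 3))"
      using bad_sum by (intro sum_mono) (simp add: sum.distrib mult.commute)
    also have "\<dots> = real (Q * p) * (2 * \<eta> / 3)"
      by (simp add: p_def)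
    finally have diff: "\<bar>?A - real Q * (real N * ?G)\<bar> \<le> real (Q * p) * (2 * \<eta> / 3)" .
    have pos: "0 < real (Q * p)"
      using Q0 p0 by simp
    have "?A / real (Q * p) - ?G / real m = (?A - real Q * (real N * ?G)) / real (Q * p)"
      using Q0 m0 N0 by (simp add: p_def field_simps)
    then have "\<bar>?A / real (Q * p) - ?G / real m\<bar> \<le> 2 * \<eta> / 3"
      using diff pos by (simp add: abs_divide divide_le_eq mult.commute)
    \<comment> \<open>Two thirds of \<eta> come from the unseen coordinates and the bad places; the
      last third, a strict bound, comes from sampling.\<close>
    then show "\<bar>?A / real (Q * p) - (\<integral>x. f x \<partial>\<mu>)\<bar> < \<eta>"
      using xs[OF f] by linarith
  qed
qed

section \<open>Generic entropy dimensions\<close>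

text \<open>The period and the word depend on \<open>V\<close> alone; the number \<open>Q\<close> of
  periods and the free symbols are left to choose, differently for the two dimensions.\<close>

lemma orbit_measures_dense:
  assumes compact: "compact (UNIV :: 'm::topological_space set)"
    and V: "openin (invariant_measure_topology euclidean (full_shift :: (int \<Rightarrow> 'm) \<Rightarrow> _)) V" "V \<noteq> {}"
  obtains p w where "0 < p" "\<And>u. w (u + int p) = w u"
    "\<And>z Q. 0 < Q \<Longrightarrow> (\<And>u. \<not> int p dvd u \<Longrightarrow> z u = w u) \<Longrightarrow> (full_shift ^^ (Q * p)) z = z
      \<Longrightarrow> orbit_measure full_shift z (Q * p) \<in> V"
proof -
  obtain U where U: "openin (weak_topology euclidean) U" "V = U \<inter> invariant_measures euclidean full_shift"
    using V(1) unfolding invariant_measure_topology_def openin_subtopology by auto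
  then obtain \<mu> where \<mu>: "\<mu> \<in> U" "\<mu> \<in> invariant_measures euclidean full_shift"
    using V(2) by auto
  obtain F \<eta> where F: "finite F" "0 < \<eta>"
      "\<And>f. f \<in> F \<Longrightarrow> continuous_map euclidean euclideanreal f \<and> bounded (f ` topspace euclidean)"
    and nbhd: "{\<nu> \<in> borel_prob_measures euclidean. \<forall>f\<in>F. \<bar>(\<integral>x. f x \<partial>\<nu>) - (\<integral>x. f x \<partial>\<mu>)\<bar> < \<eta>} \<subseteq> U"
    by (rule weak_topology_nbhd[OF U(1) \<mu>(1)]) (rule that)
  have cont: "continuous_on UNIV f" if "f \<in> F" for f
    using F(3)[OF that] by simp
  show ?thesis
  proof (rule periodic_word_approximation[OF compact \<mu>(2) F(1) cont F(2)], assumption)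
    fix p w assume p: "0 < p" and w: "\<And>u. w (u + int p) = w u"
      and approx: "\<And>z Q f. 0 < Q \<Longrightarrow> (\<And>u. \<not> int p dvd u \<Longrightarrow> z u = w u) \<Longrightarrow> f \<in> F \<Longrightarrow>
       \<bar>(\<Sum>i<Q * p. f ((full_shift ^^ i) z)) / real (Q * p) - (\<integral>x. f x \<partial>\<mu>)\<bar> < \<eta>"
    show ?thesis
    proof (rule that[of p w])
      show "0 < p" by (rule p)
      show "w (u + int p) = w u" for u by (rule w)
      fix z and Q :: nat
      assume Q: "0 < Q" and z: "\<And>u. \<not> int p dvd u \<Longrightarrow> z u = w u" and per: "(full_shift ^^ (Q * p)) z = z"
      let ?\<nu> = "orbit_measure full_shift z (Q * p)"
      have Qp: "0 < Q * p"
        using Q p by simp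
      have "\<bar>(\<integral>x. f x \<partial>?\<nu>) - (\<integral>x. f x \<partial>\<mu>)\<bar> < \<eta>" if "f \<in> F" for f
        using approx[OF Q z that] integral_orbit_measure[OF Qp borel_measurable_continuous_onI[OF cont[OF that]]]
        by simp
      then have "?\<nu> \<in> U"
        using orbit_measure_in[OF Qp] by (intro subsetD[OF nbhd]) simp
      moreover have "?\<nu> \<in> invariant_measures euclidean full_shift"
        by (rule orbit_measure_invariant[OF Qp continuous_on_full_shift per])
      ultimately show "?\<nu> \<in> V"
        unfolding U(2) by simp
    qed
  qed
qed

text \<open>The free symbols spell the binary expansions of \<open>0, \<dots>, 2\<^sup>k - 1\<close>, one after the other. A window
  of radius \<open>kp\<close> contains a complete expansion at a place determined by the position modulo \<open>kp\<close>.\<close>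

lemma periodic_point_with_rare_windows:
  fixes w :: "int \<Rightarrow> 'm::metric_space" and a b :: 'm
  assumes p: "0 < p" and w: "\<And>u. w (u + int p) = w u" and k: "0 < k" and ab: "a \<noteq> b"
  obtains z where "\<And>u. \<not> int p dvd u \<Longrightarrow> z u = w u" "(full_shift ^^ (k * 2 ^ k * p)) z = z"
    "\<And>y e. e \<le> dist a b / 2 \<Longrightarrow>
      card {i. i < k * 2 ^ k * p \<and> (\<forall>t. \<bar>t\<bar> \<le> int (k * p) \<longrightarrow> dist ((full_shift ^^ i) z t) (y t) < e)} \<le> k * p"
proof -
  define c where "c l = (if bit (l div k) (l mod k) then a else b)" for l :: nat
  \<comment> \<open>The symbol with index \<open>l\<close> sits at coordinate
    \<open>- (p * l)\<close>, in accordance with the direction of the shift.\<close>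
  define z where "z u = (if int p dvd u then c (nat ((- u div int p) mod int (k * 2 ^ k))) else w u)" for u
  have w_mult: "w (u - int n * int p) = w u" for u n
  proof (induction n)
    case (Suc n)
    then show ?case
      using w[of "u - int (Suc n) * int p"] by (simp add: algebra_simps)
  qed simp
  have z_at: "z (- int (p * l)) = c l" if "l < k * 2 ^ k" for l
  proof -
    have "int (p * l) div int p = int l"
      using p by simp
    moreover have "int l mod int (k * 2 ^ k) = int l"
      using that by (intro mod_pos_pos_trivial) (simp_all only: of_nat_less_iff of_nat_0_le_iff)
    moreover have "int p dvd - int (p * l)"
      by simp
    ultimately show ?thesis
      unfolding z_def minus_minus by (simp only: nat_int if_True)
  qed
  show ?thesis
  proof (rule that)
    show "z u = w u" if "\<not> int p dvd u" for u
      using that by (simp add: z_def)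
    show "(full_shift ^^ (k * 2 ^ k * p)) z = z"
    proof
      fix u
      let ?P = "int (k * 2 ^ k) * int p"
      have dvd: "int p dvd (u - ?P) \<longleftrightarrow> int p dvd u"
        by (simp add: dvd_diff_left_iff)
      have "- (u - ?P) div int p = - u div int p + int (k * 2 ^ k)"
        using p div_mult_self1[of "int p" "- u" "int (k * 2 ^ k)"] by (simp add: algebra_simps)
      then have "(- (u - ?P) div int p) mod int (k * 2 ^ k) = (- u div int p) mod int (k * 2 ^ k)"
        by (simp only: mod_add_self2)
      then have "z (u - ?P) = z u"
        unfolding z_def dvd using w_mult[of u "k * 2 ^ k"] by (simp only:)
      then show "(full_shift ^^ (k * 2 ^ k * p)) z u = z u"
        by (simp add: full_shift_funpow)
    qed
    fix y :: "int \<Rightarrow> 'm" and e :: real assume e: "e \<le> dist a b / 2"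
    let ?S = "{i. i < k * 2 ^ k * p \<and> (\<forall>t. \<bar>t\<bar> \<le> int (k * p) \<longrightarrow> dist ((full_shift ^^ i) z t) (y t) < e)}"
    have kp: "0 < k * p"
      using k p by simp
    \<comment> \<open>The coordinate displaying bit \<open>l\<close> of \<open>i div (k * p)\<close>
      depends on \<open>i mod (k * p)\<close> and \<open>l\<close> only. Hence, for a given residue,
      the centre \<open>y\<close> dictates all the bits.\<close>
    have symbol: "dist (if bit (i div (k * p)) l then a else b) (y (int (i mod (k * p)) - int (p * l))) < e"
      if i: "i \<in> ?S" and l: "l < k" for i l
    proof -
      let ?\<alpha> = "i div (k * p)" and ?\<rho> = "i mod (k * p)"
      let ?t = "int ?\<rho> - int (p * l)"
      have \<rho>: "?\<rho> < k * p" and pl: "p * l < k * p"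
        using kp l p by simp_all
      have "?\<alpha> < 2 ^ k"
        using i by (intro less_mult_imp_div_less) (simp add: algebra_simps)
      then have "Suc ?\<alpha> * k \<le> 2 ^ k * k"
        by (intro mult_le_mono1) simp
      then have q: "?\<alpha> * k + l < k * 2 ^ k"
        using l by (simp add: algebra_simps)
      have "i = ?\<alpha> * (k * p) + ?\<rho>"
        by (rule div_mult_mod_eq[symmetric])
      then have "int i = int (?\<alpha> * (k * p) + ?\<rho>)"
        by (rule arg_cong)
      then have "?t - int i = - int (p * (?\<alpha> * k + l))"
        by (simp add: algebra_simps)
      then have "(full_shift ^^ i) z ?t = c (?\<alpha> * k + l)"
        using z_at[OF q] by (simp only: full_shift_funpow)
      also have "\<dots> = (if bit ?\<alpha> l then a else b)"
        using l by (simp add: c_def)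
      finally have eq: "(full_shift ^^ i) z ?t = (if bit ?\<alpha> l then a else b)" .
      have "\<bar>?t\<bar> \<le> int (k * p)"
        using \<rho> pl by linarith
      then have "dist ((full_shift ^^ i) z ?t) (y ?t) < e"
        using i by blast
      then show ?thesis
        unfolding eq .
    qed
    have "inj_on (\<lambda>i. i mod (k * p)) ?S"
    proof (rule inj_onI)
      fix i j assume i: "i \<in> ?S" and j: "j \<in> ?S" and mod: "i mod (k * p) = j mod (k * p)"
      have bits: "bit (i div (k * p)) l = bit (j div (k * p)) l" if l: "l < k" for l
      proof -
        \<comment> \<open>Both symbols are closer than half of \<open>dist a b\<close> to the same
          symbol of \<open>y\<close>, so they cannot be different letters.\<close>
        have "dist (if bit (i div (k * p)) l then a else b) (if bit (j div (k * p)) l then a else b) < dist a b"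
          (is "dist ?x ?y < _")
          using symbol[OF i l] symbol[OF j l] e dist_triangle2[of ?x ?y "y (int (j mod (k * p)) - int (p * l))"]
          unfolding mod by linarith
        then show ?thesis
          by (auto simp: dist_commute split: if_splits)
      qed
      have small: "i div (k * p) < 2 ^ k" "j div (k * p) < 2 ^ k"
        using i j by (auto intro!: less_mult_imp_div_less simp: algebra_simps)
      have "take_bit k (i div (k * p)) = take_bit k (j div (k * p))"
        by (rule bit_eqI) (simp add: bit_take_bit_iff bits cong: conj_cong)
      then have "i div (k * p) = j div (k * p)"
        using small by (simp add: take_bit_nat_eq_self)
      with mod show "i = j"
        by (metis div_mult_mod_eq)
    qed
    then have "card ?S \<le> card {..<k * p}"
      by (rule card_inj_on_le) (use kp in auto)
    then show "card ?S \<le> k * p"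
      by simp
  qed
qed

section \<open>Entropy dimensions from single radii\<close>

context compact_metrized
begin

lemma entropy_quotient_eq:
  "entropy_quotient \<mu> e = - (LINT x : msupport euclidean \<mu> | \<mu>. ln (measure \<mu> (mball x e))) / - ln e"
  by (simp add: entropy_quotient_def mtopology_eq)

lemma entropy_quotient_nonneg:
  assumes \<mu>: "\<mu> \<in> borel_prob_measures euclidean" and e: "0 < e" "e < 1"
  shows "0 \<le> entropy_quotient \<mu> e"
proof -
  interpret prob_space \<mu>
    using \<mu> by (simp add: borel_prob_measures_euclidean)
  have "(LINT x : msupport euclidean \<mu> | \<mu>. ln (measure \<mu> (mball x e))) \<le> ln 1"
    by (rule entropy_integral_le[OF \<mu> e(1)]) auto
  then show ?thesis
    using e by (simp add: entropy_quotient_eq divide_nonpos_neg)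
qed

text \<open>Good radii tending to 0 bound the limit inferior from above; nonnegativity of the
  quotient for radii below 1 bounds it from below.\<close>

lemma lower_entropy_dim_eq_0:
  assumes \<mu>: "\<mu> \<in> borel_prob_measures euclidean"
    and small: "\<And>n. \<exists>e>0. e < 1 / real (Suc n) \<and> entropy_quotient \<mu> e \<le> 1 / real (Suc n)"
  shows "lower_entropy_dim \<mu> = 0"
proof (rule antisym)
  show "lower_entropy_dim \<mu> \<le> 0"
  proof (rule ccontr)
    assume "\<not> lower_entropy_dim \<mu> \<le> 0"
    then obtain c :: real where c: "0 < ereal c" "ereal c < lower_entropy_dim \<mu>"
      using ereal_dense2[of 0 "lower_entropy_dim \<mu>"] by (auto simp: not_le)
    then have "eventually (\<lambda>e. ereal c < ereal (entropy_quotient \<mu> e)) (at_right 0)"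
      unfolding lower_entropy_dim_def by (intro less_LiminfD)
    then obtain d where d: "0 < d" "\<And>e. 0 < e \<Longrightarrow> e < d \<Longrightarrow> c < entropy_quotient \<mu> e"
      unfolding eventually_at_right_field by auto
    obtain n where n: "1 / real (Suc n) < min c d"
      using nat_approx_posE[of "min c d"] c(1) d(1) by auto
    obtain e where "0 < e" "e < 1 / real (Suc n)" "entropy_quotient \<mu> e \<le> 1 / real (Suc n)"
      using small by blast
    then show False
      using d(2)[of e] n by simp
  qed
  have "eventually (\<lambda>e. 0 \<le> ereal (entropy_quotient \<mu> e)) (at_right 0)"
    unfolding eventually_at_right_field
    by (intro exI[of _ 1]) (auto intro: entropy_quotient_nonneg[OF \<mu>])
  then show "0 \<le> lower_entropy_dim \<mu>"
    unfolding lower_entropy_dim_def by (rule Liminf_bounded)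
qed

lemma upper_entropy_dim_eq_PInfty:
  assumes large: "\<And>n. \<exists>e>0. e < 1 / real (Suc n) \<and> real n \<le> entropy_quotient \<mu> e"
  shows "upper_entropy_dim \<mu> = \<infinity>"
proof (rule ccontr)
  assume "upper_entropy_dim \<mu> \<noteq> \<infinity>"
  then obtain c :: real where c: "upper_entropy_dim \<mu> < ereal c"
    using less_PInf_Ex_of_nat by (metis ereal_infty_less(1))
  then have "eventually (\<lambda>e. ereal (entropy_quotient \<mu> e) < ereal c) (at_right 0)"
    unfolding upper_entropy_dim_def by (intro Limsup_lessD)
  then obtain d where d: "0 < d" "\<And>e. 0 < e \<Longrightarrow> e < d \<Longrightarrow> entropy_quotient \<mu> e < c"
    unfolding eventually_at_right_field by auto
  obtain m where m: "1 / real (Suc m) < d"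
    using nat_approx_posE[OF d(1)] .
  obtain k where k: "c < real k"
    using reals_Archimedean2 by blast
  define n where "n = max m k"
  have "1 / real (Suc n) \<le> 1 / real (Suc m)"
    by (rule frac_le) (auto simp: n_def)
  moreover obtain e where "0 < e" "e < 1 / real (Suc n)" "real n \<le> entropy_quotient \<mu> e"
    using large by blast
  ultimately show False
    using d(2)[of e] m k by (simp add: n_def)
qed

end

section \<open>Density of measures with small or large entropy quotients\<close>

lemma residual_lower_entropy_dim:
  fixes d :: "(int \<Rightarrow> 'm::topological_space) \<Rightarrow> (int \<Rightarrow> 'm) \<Rightarrow> real"
  assumes d: "compact_metrized d" and compact: "compact (UNIV :: 'm set)"
  shows "residual_in (invariant_measure_topology euclidean full_shift)
    {\<mu> \<in> invariant_measures euclidean full_shift. Metric_space.lower_entropy_dim UNIV d \<mu> = 0}"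
proof -
  interpret compact_metrized d by fact
  let ?inv = "invariant_measures euclidean (full_shift :: (int \<Rightarrow> 'm) \<Rightarrow> _)"
  let ?Y = "invariant_measure_topology euclidean (full_shift :: (int \<Rightarrow> 'm) \<Rightarrow> _)"
  define G where "G n = {\<mu> \<in> ?inv. \<exists>e>0. e < 1 / real (Suc n) \<and> entropy_quotient \<mu> e \<le> 1 / real (Suc n)}" for n
  have top: "topspace ?Y = ?inv"
    by (auto simp: invariant_measure_topology_def invariant_measures_def)
  show ?thesis
  proof (rule residual_inI[of _ _ G])
    show "{\<mu> \<in> ?inv. lower_entropy_dim \<mu> = 0} \<subseteq> topspace ?Y"
      unfolding top by (rule Collect_restrict)
    show "(\<Inter>n. G n) \<subseteq> {\<mu> \<in> ?inv. lower_entropy_dim \<mu> = 0}"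
    proof
      fix \<mu> assume "\<mu> \<in> (\<Inter>n. G n)"
      then have G: "\<mu> \<in> G n" for n by (rule INT_D) simp
      then have inv: "\<mu> \<in> ?inv"
        by (simp add: G_def)
      have "lower_entropy_dim \<mu> = 0"
      proof (rule lower_entropy_dim_eq_0)
        show "\<mu> \<in> borel_prob_measures euclidean"
          using inv by (simp add: invariant_measures_def)
        show "\<exists>e>0. e < 1 / real (Suc n) \<and> entropy_quotient \<mu> e \<le> 1 / real (Suc n)" for n
          using G[of n] by (simp add: G_def)
      qed
      with inv show "\<mu> \<in> {\<mu> \<in> ?inv. lower_entropy_dim \<mu> = 0}"
        by simp
    qed
    fix n V assume V: "openin ?Y V" "V \<noteq> {}"
    obtain p w where p: "0 < p" and w: "\<And>u. w (u + int p) = w u"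
      and mem: "\<And>z Q. 0 < Q \<Longrightarrow> (\<And>u. \<not> int p dvd u \<Longrightarrow> z u = w u) \<Longrightarrow> (full_shift ^^ (Q * p)) z = z
        \<Longrightarrow> orbit_measure full_shift z (Q * p) \<in> V"
      using orbit_measures_dense[OF compact V] by blast
    define \<nu> where "\<nu> = orbit_measure full_shift w p"
    define A where "A = (\<lambda>i. (full_shift ^^ i) w) ` {..<p}"
    have "w (u - int p) = w u" for u
      using w[of "u - int p"] by simp
    then have per: "(full_shift ^^ p) w = w"
      by (simp add: full_shift_funpow)
    \<comment> \<open>One period, with the free symbols left as they are in
      \<open>w\<close>.\<close>
    have \<nu>_V: "\<nu> \<in> V"
      using mem[of 1 w] per by (simp add: \<nu>_def)
    have \<nu>: "\<nu> \<in> borel_prob_measures euclidean" "\<nu> \<in> ?inv"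
      unfolding \<nu>_def using p per
      by (auto intro: orbit_measure_in orbit_measure_invariant continuous_on_full_shift)
    have A: "finite A" "card A \<le> p"
      using card_image_le[of "{..<p}"] by (auto simp: A_def)
    have AE_A: "AE x in \<nu>. x \<in> A"
      unfolding \<nu>_def using p A(1) by (intro AE_orbit_measure finite_borel) (auto simp: A_def)
    \<comment> \<open>This is \<open>-ln\<close> of the radius: it makes \<open>(p + 1) / c\<close>
      equal to \<open>1 / Suc n\<close>, and being at least \<open>Suc n\<close> it also makes the
      radius itself smaller than \<open>1 / Suc n\<close>.\<close>
    define c where "c = (real p + 1) * real (Suc n)"
    have c: "real (Suc n) \<le> c"
      unfolding c_def using mult_right_mono[of 1 "real p + 1" "real (Suc n)"] by simp
    then have c0: "0 < c"
      by (rule less_le_trans[rotated]) simp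
    have "real (Suc n) < exp c"
      using c exp_ge_add_one_self[of c] by linarith
    then have e_small: "exp (- c) < 1 / real (Suc n)"
      by (simp add: exp_minus field_simps)
    obtain W where W: "openin (weak_topology euclidean) W" "\<nu> \<in> W"
      and bound: "\<And>\<mu>. \<mu> \<in> W \<Longrightarrow>
        - (LINT x : msupport euclidean \<mu> | \<mu>. ln (measure \<mu> (mball x (exp (- c))))) \<le> real (card A) + 1"
      using small_entropy_nbhd[OF \<nu>(1) AE_A A(1), of "exp (- c)"] by auto
    have "entropy_quotient \<mu> (exp (- c)) \<le> 1 / real (Suc n)" if "\<mu> \<in> W" for \<mu>
    proof -
      have "entropy_quotient \<mu> (exp (- c))
          = - (LINT x : msupport euclidean \<mu> | \<mu>. ln (measure \<mu> (mball x (exp (- c))))) / c"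
        by (simp only: entropy_quotient_eq ln_exp minus_minus)
      also have "\<dots> \<le> (real p + 1) / c"
        using bound[OF that] A(2) c0 by (intro divide_right_mono) auto
      also have "\<dots> = 1 / real (Suc n)"
        by (simp add: c_def)
      finally show ?thesis .
    qed
    then have "W \<inter> ?inv \<subseteq> G n"
      using e_small by (auto simp: G_def intro!: exI[of _ "exp (- c)"])
    moreover have "openin ?Y (W \<inter> ?inv)"
      unfolding invariant_measure_topology_def openin_subtopology using W(1) by (intro exI[of _ W]) simp
    ultimately show "\<exists>W. openin ?Y W \<and> V \<inter> W \<noteq> {} \<and> W \<subseteq> G n"
      using \<nu>_V \<nu>(2) W(2) by (intro exI[of _ "W \<inter> ?inv"]) auto
  qed
qed

lemma residual_upper_entropy_dim:
  fixes a :: "nat \<Rightarrow> real" and u v :: "'m::metric_space"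
  assumes compact: "compact (UNIV :: 'm set)" and uv: "u \<noteq> v"
    and a_mono: "mono a" and a_nonneg: "\<And>k. 0 \<le> a k" and a_sum: "summable (\<lambda>k. 1 / (a k + 1))"
    and growth: "\<And>\<alpha>::real. \<alpha> > 0 \<Longrightarrow> (\<lambda>k. a k / exp (\<alpha> * real k)) \<longlonglongrightarrow> 0"
    and d: "compact_metrized (seq_dist a :: (int \<Rightarrow> 'm) \<Rightarrow> _)"
  shows "residual_in (invariant_measure_topology euclidean (full_shift :: (int \<Rightarrow> 'm) \<Rightarrow> _))
    {\<mu> \<in> invariant_measures euclidean full_shift. Metric_space.upper_entropy_dim UNIV (seq_dist a) \<mu> = \<infinity>}"
proof -
  interpret compact_metrized "seq_dist a :: (int \<Rightarrow> 'm) \<Rightarrow> _" by fact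
  let ?inv = "invariant_measures euclidean (full_shift :: (int \<Rightarrow> 'm) \<Rightarrow> _)"
  let ?Y = "invariant_measure_topology euclidean (full_shift :: (int \<Rightarrow> 'm) \<Rightarrow> _)"
  define G where "G n = {\<mu> \<in> ?inv. \<exists>e>0. e < 1 / real (Suc n) \<and> real n \<le> entropy_quotient \<mu> e}" for n
  have top: "topspace ?Y = ?inv"
    by (auto simp: invariant_measure_topology_def invariant_measures_def)
  show ?thesis
  proof (rule residual_inI[of _ _ G])
    show "{\<mu> \<in> ?inv. upper_entropy_dim \<mu> = \<infinity>} \<subseteq> topspace ?Y"
      unfolding top by (rule Collect_restrict)
    show "(\<Inter>n. G n) \<subseteq> {\<mu> \<in> ?inv. upper_entropy_dim \<mu> = \<infinity>}"
    proof
      fix \<mu> assume "\<mu> \<in> (\<Inter>n. G n)"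
      then have G: "\<mu> \<in> G n" for n by (rule INT_D) simp
      have "\<exists>e>0. e < 1 / real (Suc n) \<and> real n \<le> entropy_quotient \<mu> e" for n
        using G[of n] by (simp add: G_def)
      then have "upper_entropy_dim \<mu> = \<infinity>"
        by (rule upper_entropy_dim_eq_PInfty)
      moreover have "\<mu> \<in> ?inv"
        using G by (simp add: G_def)
      ultimately show "\<mu> \<in> {\<mu> \<in> ?inv. upper_entropy_dim \<mu> = \<infinity>}"
        by simp
    qed
    fix n V assume V: "openin ?Y V" "V \<noteq> {}"
    obtain p w where p: "0 < p" and w: "\<And>u. w (u + int p) = w u"
      and mem: "\<And>z Q. 0 < Q \<Longrightarrow> (\<And>u. \<not> int p dvd u \<Longrightarrow> z u = w u) \<Longrightarrow> (full_shift ^^ (Q * p)) z = z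
        \<Longrightarrow> orbit_measure full_shift z (Q * p) \<in> V"
      using orbit_measures_dense[OF compact V] by blast
    \<comment> \<open>Chosen so that \<open>n * \<alpha> * k * p\<close> is at most half of
      \<open>k * ln 2\<close>; the other half absorbs the additive constants.\<close>
    define \<alpha> where "\<alpha> = ln 2 / (2 * (real n + 1) * real p)"
    have \<alpha>: "0 < \<alpha>"
      using p by (simp add: \<alpha>_def)
    have sub: "filterlim (\<lambda>k. k * p) at_top sequentially"
      using p by (intro filterlim_subseq) (simp add: strict_mono_def)
    have "(\<lambda>k. 1 / (a (k * p) + 1)) \<longlonglongrightarrow> 0"
      using filterlim_compose[OF summable_LIMSEQ_zero[OF a_sum] sub] .
    moreover have "0 < min (dist u v / 2) (1 / real (Suc n))"
      using uv by simp
    ultimately have "eventually (\<lambda>k. 1 / (a (k * p) + 1) < min (dist u v / 2) (1 / real (Suc n))) sequentially"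
      by (rule order_tendstoD(2))
    moreover have "(\<lambda>k. a (k * p) / exp (\<alpha> * real (k * p))) \<longlonglongrightarrow> 0"
      using filterlim_compose[OF growth[OF \<alpha>] sub] .
    then have "eventually (\<lambda>k. a (k * p) / exp (\<alpha> * real (k * p)) < 1) sequentially"
      by (rule order_tendstoD(2)) simp
    \<comment> \<open>Equivalent to \<open>2 * n + k / 2 \<le> k - 1\<close>. Here
      \<open>2 * n\<close> accounts for two extra \<open>ln 2\<close>, one from
      \<open>a + 1 \<le> 2 * exp\<close>, the other from halving the radius.\<close>
    moreover have "eventually (\<lambda>k. 4 * n + 2 \<le> k) sequentially"
      by (rule eventually_ge_at_top)
    ultimately have "eventually (\<lambda>k. 1 / (a (k * p) + 1) < min (dist u v / 2) (1 / real (Suc n))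
        \<and> a (k * p) / exp (\<alpha> * real (k * p)) < 1 \<and> 4 * n + 2 \<le> k) sequentially"
      by eventually_elim simp
    then obtain k where k: "1 / (a (k * p) + 1) < min (dist u v / 2) (1 / real (Suc n))"
        "a (k * p) / exp (\<alpha> * real (k * p)) < 1" "4 * n + 2 \<le> k"
      using eventually_happens'[OF sequentially_bot] by blast
    have k0: "0 < k"
      using k(3) by simp
    \<comment> \<open>The cutoff at coordinate \<open>k * p\<close>; by monotonicity of
      \<open>a\<close> it is below the cutoffs at all coordinates of the window, so a ball of radius
      \<open>e\<close> restricts each of them.\<close>
    define e where "e = 1 / (a (k * p) + 1)"
    have e: "0 < e" "e < dist u v / 2" "e < 1 / real (Suc n)"
      using k(1) a_nonneg[of "k * p"] by (simp_all add: e_def)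
    have "1 / real (Suc n) \<le> 1" by simp
    then have "e < 1"
      using e(3) by linarith
    then have ln_e: "0 < - ln (e / 2)"
      using e(1) by (simp add: ln_less_zero)
    have ln_bound: "real n * - ln (e / 2) \<le> (real k - 1) * ln 2"
    proof -
      have "ln e = - ln (a (k * p) + 1)"
        using a_nonneg[of "k * p"] by (simp add: e_def ln_div)
      then have "- ln (e / 2) = ln (a (k * p) + 1) + ln 2"
        using e(1) by (simp add: ln_div)
      moreover have "ln (a (k * p) + 1) \<le> ln (2 * exp (\<alpha> * real (k * p)))"
      proof (rule ln_mono)
        have "1 \<le> exp (\<alpha> * real (k * p))"
          using \<alpha> by simp
        moreover have "a (k * p) < exp (\<alpha> * real (k * p))"
          using k(2) by (simp add: divide_less_eq)
        ultimately show "a (k * p) + 1 \<le> 2 * exp (\<alpha> * real (k * p))"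
          by linarith
      qed (use a_nonneg[of "k * p"] in auto)
      moreover have "ln (2 * exp (\<alpha> * real (k * p))) = ln 2 + real k * ln 2 / (2 * (real n + 1))"
        using p by (simp add: ln_mult \<alpha>_def)
      ultimately have "- ln (e / 2) \<le> 2 * ln 2 + real k * ln 2 / (2 * (real n + 1))"
        by simp
      then have "real n * - ln (e / 2) \<le> real n * (2 * ln 2 + real k * ln 2 / (2 * (real n + 1)))"
        by (intro mult_left_mono) auto
      also have "\<dots> = (2 * real n + real n / (real n + 1) * (real k / 2)) * ln 2"
        by (simp add: field_simps)
      also have "\<dots> \<le> (2 * real n + 1 * (real k / 2)) * ln 2"
        by (intro mult_right_mono add_left_mono) auto
      also have "\<dots> \<le> (real k - 1) * ln 2"
        using k(3) by (intro mult_right_mono) auto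
      finally show ?thesis .
    qed
    obtain z where z: "\<And>t. \<not> int p dvd t \<Longrightarrow> z t = w t" "(full_shift ^^ (k * 2 ^ k * p)) z = z"
      and rare: "\<And>y e. e \<le> dist u v / 2 \<Longrightarrow> card {i. i < k * 2 ^ k * p \<and>
        (\<forall>t. \<bar>t\<bar> \<le> int (k * p) \<longrightarrow> dist ((full_shift ^^ i) z t) (y t) < e)} \<le> k * p"
      using periodic_point_with_rare_windows[of p w k u v, OF p w k0 uv] by blast
    define P where "P = k * 2 ^ k * p"
    have P: "0 < P"
      using k0 p by (simp add: P_def)
    define \<nu> where "\<nu> = orbit_measure full_shift z P"
    have \<nu>_V: "\<nu> \<in> V"
      using mem[of "k * 2 ^ k" z] z k0 by (simp add: \<nu>_def P_def)
    have \<nu>: "\<nu> \<in> borel_prob_measures euclidean" "\<nu> \<in> ?inv"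
      unfolding \<nu>_def using P z(2)
      by (auto intro: orbit_measure_in orbit_measure_invariant continuous_on_full_shift simp: P_def)
    \<comment> \<open>At most \<open>k * p\<close> of the \<open>k * 2 ^ k * p\<close> times fall
      into the ball. The factor 2 provides a strict inequality and costs one \<open>ln 2\<close>,
      whence \<open>real k - 1\<close> in \<open>ln_bound\<close>.\<close>
    have rare_ball: "measure \<nu> (mball y e) < 2 / 2 ^ k" for y
    proof -
      have "card {i. i < P \<and> (full_shift ^^ i) z \<in> mball y e}
          \<le> card {i. i < P \<and> (\<forall>t. \<bar>t\<bar> \<le> int (k * p) \<longrightarrow> dist ((full_shift ^^ i) z t) (y t) < e)}"
      proof (rule card_mono, rule finite_Collect_conjI, simp,
          intro Collect_mono impI, elim conjE, intro conjI allI impI)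
        fix i t assume y: "(full_shift ^^ i) z \<in> mball y e" and t: "\<bar>t\<bar> \<le> int (k * p)"
        have "a (nat \<bar>t\<bar>) \<le> a (k * p)"
          using t by (intro monoD[OF a_mono]) linarith
        then have "e \<le> 1 / (a (nat \<bar>t\<bar>) + 1)"
          unfolding e_def using a_nonneg[of "nat \<bar>t\<bar>"] by (intro divide_left_mono) auto
        then have "dist (y t) ((full_shift ^^ i) z t) < e"
          using y by (intro dist_less_if_seq_dist_less[OF a_nonneg a_sum, of y]) auto
        then show "dist ((full_shift ^^ i) z t) (y t) < e"
          by (simp add: dist_commute)
      qed
      also have "\<dots> \<le> k * p"
        unfolding P_def by (rule rare[OF less_imp_le[OF e(2)]])
      finally have "measure \<nu> (mball y e) \<le> real (k * p) / real P"
        unfolding \<nu>_def measure_orbit_measure[OF P mball_borel] by (intro divide_right_mono) (simp_all only: of_nat_le_iff of_nat_0_le_iff)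
      also have "\<dots> = 1 / 2 ^ k"
        using k0 p by (simp add: P_def)
      also have "\<dots> < 2 / 2 ^ k"
        by (intro divide_strict_right_mono) auto
      finally show ?thesis .
    qed
    obtain W where W: "openin (weak_topology euclidean) W" "\<nu> \<in> W"
      and bound: "\<And>\<mu> x. \<mu> \<in> W \<Longrightarrow> measure \<mu> (mball x (e / 2)) < 2 / 2 ^ k"
      using small_balls_nbhd[OF \<nu>(1) e(1) rare_ball] by blast
    have "real n \<le> entropy_quotient \<mu> (e / 2)" if \<mu>: "\<mu> \<in> W" "\<mu> \<in> ?inv" for \<mu>
    proof -
      have "(LINT x : msupport euclidean \<mu> | \<mu>. ln (measure \<mu> (mball x (e / 2)))) \<le> ln (2 / 2 ^ k)"
        using \<mu>(2) e(1) less_imp_le[OF bound[OF \<mu>(1)]]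
        by (intro entropy_integral_le) (simp_all add: invariant_measures_def)
      also have "\<dots> = - ((real k - 1) * ln 2)"
        by (simp add: ln_div ln_realpow algebra_simps)
      finally have "real n * - ln (e / 2)
          \<le> - (LINT x : msupport euclidean \<mu> | \<mu>. ln (measure \<mu> (mball x (e / 2))))"
        using ln_bound by linarith
      then show ?thesis
        unfolding entropy_quotient_eq using ln_e by (subst pos_le_divide_eq) auto
    qed
    moreover have "0 < e / 2" "e / 2 < 1 / real (Suc n)"
      using e by linarith+
    ultimately have "W \<inter> ?inv \<subseteq> G n"
      unfolding G_def by blast
    moreover have "openin ?Y (W \<inter> ?inv)"
      unfolding invariant_measure_topology_def openin_subtopology using W(1) by (intro exI[of _ W]) simp
    ultimately show "\<exists>W. openin ?Y W \<and> V \<inter> W \<noteq> {} \<and> W \<subseteq> G n"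
      using \<nu>_V \<nu>(2) W(2) by (intro exI[of _ "W \<inter> ?inv"]) auto
  qed
qed

theorem corollary1p4:
  fixes a :: "nat \<Rightarrow> real"
  assumes "compact (UNIV :: 'm::{metric_space, perfect_space} set)"
    and "mono a"
    and "\<And>k. 0 \<le> a k"
    and "summable (\<lambda>k. 1 / (a k + 1))"
    and "\<And>\<alpha>::real. \<alpha> > 0 \<Longrightarrow> (\<lambda>k. a k / exp (\<alpha> * real k)) \<longlonglongrightarrow> 0"
  shows "residual_in
           (invariant_measure_topology (seq_topology a) (full_shift :: (int \<Rightarrow> 'm) \<Rightarrow> (int \<Rightarrow> 'm)))
           {\<mu> \<in> invariant_measures (seq_topology a) full_shift.
              Metric_space.lower_entropy_dim UNIV (seq_dist a) \<mu> = 0}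
       \<and> residual_in
           (invariant_measure_topology (seq_topology a) (full_shift :: (int \<Rightarrow> 'm) \<Rightarrow> (int \<Rightarrow> 'm)))
           {\<mu> \<in> invariant_measures (seq_topology a) full_shift.
              Metric_space.upper_entropy_dim UNIV (seq_dist a) \<mu> = \<infinity>}"
proof -
  note top = seq_topology_eq_euclidean[OF assms(3,4)]
  have metrized: "compact_metrized (seq_dist a :: (int \<Rightarrow> 'm) \<Rightarrow> _)"
    by (intro compact_metrized.intro compact_metrized_axioms.intro Metric_space_seq_dist top
        compact_UNIV_fun assms)
  \<comment> \<open>Perfectness yields the two letters of the binary code.\<close>
  obtain u v :: 'm where uv: "u \<noteq> v"
    using UNIV_not_singleton by (metis UNIV_I UNIV_eq_I singletonD singletonI)
  show ?thesis
    unfolding top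
    by (intro conjI residual_lower_entropy_dim[OF metrized assms(1)]
        residual_upper_entropy_dim[OF assms(1) uv assms(2-5) metrized])
qed

end
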